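(* Let $N\ge 2$, $w>0$, $X_0>0$, and assume that the asset price process $S$ satisfies (A1) and (A2). Define backwards recursively the weight functions on $(w,\infty)$ by $$g_{N-2}(k):=\Gamma_{N-1}(w\,|\,k-w),\qquad g_t(k):=\int_w^\infty\Gamma_{t+1}(k'\,|\,k-w)\,g_{t+1}(k')\,dk'\quad(t=0,\dots,N-3).$$ Then for every $t=0,\dots,N-2$, on the event $\{\tau>t\}$, the withdrawal guarantee value satisfies $$V_t=\int_{w/\zeta_t}^\infty\zeta_t^2\, g_t(\zeta_t k')\,P_t(k'\,|\,S_t)\,dk'=\int_w^\infty g_t(k)\,P_t(k\,|\,X_t)\,dk .$$ In particular $V_0=\int_w^\infty g_0(k)\,P_0(k\,|\,X_0)\,dk$.
   Context: Withdrawal times are $0=T_0<T_1<\dots<T_N$ (equidistant). $(S_t)_{t=0,\dots,N}$ is the positive price process of an asset at times $T_t$, under the pricing measure $\mathbb Q$ with filtration $(\mathcal F_t)$; $\mathbb E_t^{\mathbb Q}$ is conditional expectation given $\mathcal F_t$. Interest rates are zero, $S$ is a $\mathbb Q$-martingale, $S_0=1$. $P_t(K\,|\,s)=\mathbb E^{\mathbb Q}[(K-S_{t+1})^+\,|\,S_t=s]$ ($K,s>0$) is the value at $T_t$ of a put on $S$ with strike $K$ and maturity $T_{t+1}$, given spot $s$; $\Gamma_t(K\,|\,s)=\partial_s^2P_t(K\,|\,s)$. Conditional statements given $S_t=s$ refer to the transition kernels, for all $s>0$. (A1): $S$ is a one-factor Markov process with respect to $(\mathcal F_t)$, and $S_t$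 is continuously distributed; as part of this regularity, $P_t(K|s)$ is taken to be twice differentiable in $K$ and in $s$. (A2): $P_t(\alpha K\,|\,\alpha s)=\alpha P_t(K\,|\,s)$ for all $\alpha,K,s>0$ and $t=0,\dots,N-1$ (independent returns). Withdrawal fund: $X_{t+1}=X_t\cdot S_{t+1}/S_t-w$ for $t=0,\dots,N-1$ (initial value $X_0>0$, constant withdrawal $w>0$). $\zeta_t:=X_t/S_t$. Depletion time: $\tau:=\inf\{t: X_t\le 0\}$. Guarantee claims: $Z^{(0)}=0$ and $Z^{(t)}=w\,\mathbf 1_{\tau\le t-1}+X_t^-\,\mathbf 1_{\tau=t}$ for $t=1,\dots,N$, where $x^-=-\min(0,x)$. Guarantee value: $V_t:=\mathbb E_t^{\mathbb Q}\big[\sum_{u=t}^N Z^{(u)}\big]$. *)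

theory Defs
  imports "HOL-Probability.Probability"
begin

text \<open>
  Time is the index \<open>t = 0, ..., N\<close> of the withdrawal dates. Filtrations and processes are indexed
  by all natural numbers, but nothing is required of their values beyond \<open>N\<close> (a filtration on
  \<open>{0..N}\<close> is extended by repeating its last member).
\<close>

definition martingale_upto ::
    "nat \<Rightarrow> 'a measure \<Rightarrow> (nat \<Rightarrow> 'a measure) \<Rightarrow> (nat \<Rightarrow> 'a \<Rightarrow> real) \<Rightarrow> bool" where
  "martingale_upto N M F S \<longleftrightarrow>
     (\<forall>t\<le>N. S t \<in> borel_measurable (F t) \<and> integrable M (S t)) \<and>
     (\<forall>s t. s \<le> t \<longrightarrow> t \<le> N \<longrightarrow> (AE \<omega> in M. real_cond_exp M (F s) (S t) \<omega> = S s \<omega>))"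

text \<open>
  One-factor Markov property with respect to \<open>F\<close>: \<open>\<kappa> t\<close> is the transition kernel from time \<open>t\<close> to
  time \<open>t + 1\<close>, a probability kernel on the state space of positive reals, given for every spot
  \<open>s > 0\<close> (not just almost every one).
\<close>

definition markov_with_kernels ::
    "nat \<Rightarrow> 'a measure \<Rightarrow> (nat \<Rightarrow> 'a measure) \<Rightarrow> (nat \<Rightarrow> 'a \<Rightarrow> real) \<Rightarrow> (nat \<Rightarrow> real \<Rightarrow> real measure) \<Rightarrow> bool"
  where
  "markov_with_kernels N M F S \<kappa> \<longleftrightarrow>
     (\<forall>t\<le>N. S t \<in> borel_measurable (F t)) \<and>
     (\<forall>t<N. \<kappa> t \<in> measurable (restrict_space borel {0<..}) (prob_algebra borel) \<and>
            (\<forall>s>0. AE x in \<kappa> t s. 0 < x) \<and>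
            (\<forall>A\<in>sets borel. AE \<omega> in M.
               real_cond_exp M (F t) (\<lambda>\<omega>. indicator A (S (t + 1) \<omega>)) \<omega> = measure (\<kappa> t (S t \<omega>)) A))"

definition put_price :: "(nat \<Rightarrow> real \<Rightarrow> real measure) \<Rightarrow> nat \<Rightarrow> real \<Rightarrow> real \<Rightarrow> real" where
  "put_price \<kappa> t K s = (\<integral>x. max (K - x) 0 \<partial>\<kappa> t s)"

definition put_gamma :: "(nat \<Rightarrow> real \<Rightarrow> real measure) \<Rightarrow> nat \<Rightarrow> real \<Rightarrow> real \<Rightarrow> real" where
  "put_gamma \<kappa> t K s = deriv (deriv (\<lambda>s. put_price \<kappa> t K s)) s"

text \<open>Only used for open \<open>A\<close>, where \<^const>\<open>deriv\<close> is determined by the values on \<open>A\<close>.\<close>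

definition twice_differentiable_on :: "(real \<Rightarrow> real) \<Rightarrow> real set \<Rightarrow> bool" where
  "twice_differentiable_on f A \<longleftrightarrow> f differentiable_on A \<and> deriv f differentiable_on A"

text \<open>
  The initial value \<open>S 0\<close> is deterministic, so the distributions are required to
  be continuous (to have a density) from time 1 on.
\<close>

definition regular_markov ::
    "nat \<Rightarrow> 'a measure \<Rightarrow> (nat \<Rightarrow> 'a measure) \<Rightarrow> (nat \<Rightarrow> 'a \<Rightarrow> real) \<Rightarrow> (nat \<Rightarrow> real \<Rightarrow> real measure) \<Rightarrow> bool"
  where
  "regular_markov N M F S \<kappa> \<longleftrightarrow>
     markov_with_kernels N M F S \<kappa> \<and>
     (\<forall>t\<in>{1..N}. \<exists>f. distributed M lborel (S t) f) \<and>
     (\<forall>t<N. (\<forall>s>0. twice_differentiable_on (\<lambda>K. put_price \<kappa> t K s) {0<..}) \<and>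
            (\<forall>K>0. twice_differentiable_on (\<lambda>s. put_price \<kappa> t K s) {0<..}))"

definition independent_returns :: "nat \<Rightarrow> (nat \<Rightarrow> real \<Rightarrow> real measure) \<Rightarrow> bool" where
  "independent_returns N \<kappa> \<longleftrightarrow>
     (\<forall>t<N. \<forall>\<alpha>>0. \<forall>K>0. \<forall>s>0. put_price \<kappa> t (\<alpha> * K) (\<alpha> * s) = \<alpha> * put_price \<kappa> t K s)"

primrec fund :: "(nat \<Rightarrow> 'a \<Rightarrow> real) \<Rightarrow> real \<Rightarrow> real \<Rightarrow> nat \<Rightarrow> 'a \<Rightarrow> real" where
  "fund S w x0 0 \<omega> = x0"
| "fund S w x0 (Suc t) \<omega> = fund S w x0 t \<omega> * (S (Suc t) \<omega> / S t \<omega>) - w"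

definition fund_units :: "(nat \<Rightarrow> 'a \<Rightarrow> real) \<Rightarrow> real \<Rightarrow> real \<Rightarrow> nat \<Rightarrow> 'a \<Rightarrow> real" where
  "fund_units S w x0 t \<omega> = fund S w x0 t \<omega> / S t \<omega>"

text \<open>The infimum is taken in \<^typ>\<open>enat\<close>, so it is \<open>\<infinity>\<close> if the fund is never depleted.\<close>

definition depletion_time :: "nat \<Rightarrow> (nat \<Rightarrow> 'a \<Rightarrow> real) \<Rightarrow> real \<Rightarrow> real \<Rightarrow> 'a \<Rightarrow> enat" where
  "depletion_time N S w x0 \<omega> = (INF t\<in>{t. t \<le> N \<and> fund S w x0 t \<omega> \<le> 0}. enat t)"

definition guarantee_claim ::
    "nat \<Rightarrow> (nat \<Rightarrow> 'a \<Rightarrow> real) \<Rightarrow> real \<Rightarrow> real \<Rightarrow> nat \<Rightarrow> 'a \<Rightarrow> real" where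
  "guarantee_claim N S w x0 t \<omega> =
     (if t = 0 then 0
      else w * of_bool (depletion_time N S w x0 \<omega> \<le> enat (t - 1))
           + (- min 0 (fund S w x0 t \<omega>)) * of_bool (depletion_time N S w x0 \<omega> = enat t))"

definition guarantee_value ::
    "nat \<Rightarrow> 'a measure \<Rightarrow> (nat \<Rightarrow> 'a measure) \<Rightarrow> (nat \<Rightarrow> 'a \<Rightarrow> real) \<Rightarrow> real \<Rightarrow> real \<Rightarrow> nat \<Rightarrow> 'a \<Rightarrow> real"
  where
  "guarantee_value N M F S w x0 t =
     real_cond_exp M (F t) (\<lambda>\<omega>. \<Sum>u=t..N. guarantee_claim N S w x0 u \<omega>)"

text \<open>Only the arguments \<open>t \<le> N - 2\<close> and \<open>k > w\<close> are meaningful.\<close>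

function weight ::
    "(nat \<Rightarrow> real \<Rightarrow> real measure) \<Rightarrow> nat \<Rightarrow> real \<Rightarrow> nat \<Rightarrow> real \<Rightarrow> real" where
  "weight \<kappa> N w t k =
     (if N \<le> t + 2 then put_gamma \<kappa> (N - 1) w (k - w)
      else (LINT k':{w<..}|lborel. put_gamma \<kappa> (t + 1) k' (k - w) * weight \<kappa> N w (t + 1) k'))"
  by pat_completeness auto
termination
  by (relation "Wellfounded.measure (\<lambda>(\<kappa>, N, w, t, k). N - t)") auto

declare weight.simps [simp del]

end

theory Submission
  imports Defs
begin

text \<open>
  Homogeneity of the put prices makes the returns independent of the spot: \<open>\<kappa> t s\<close> is the law of
  \<open>s * r\<close> with \<open>r\<close> distributed according to \<open>\<kappa> t 1\<close>, which has mean 1 and a density \<open>f t\<close>, and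
  \<open>\<Gamma>\<^sub>t(K | s) = K\<^sup>2 / s\<^sup>3 * f t (K / s)\<close>. The substitution \<open>r = K / s\<close> then gives, for all real \<open>y\<close>,
  \<open>\<integral>\<^bsub>s>0\<^esub> \<Gamma>\<^sub>t(K | s) (s - y)\<^sup>+ ds = E (K - y r)\<^sup>+\<close>.
  Let \<open>D\<^sub>t(x)\<close> be the value at time \<open>t\<close> of the remaining claims if the fund stands at \<open>x\<close> and was
  never depleted before. By backward induction \<open>D\<^bsub>t+1\<^esub>(y - w) = \<integral> (k - y)\<^sup>+ g\<^sub>t(k) dk\<close>
  for all real \<open>y\<close>: the integrand is nonnegative, so Tonelli's theorem and the formula above carry the
  identity from \<open>t + 1\<close> to \<open>t\<close>, the start being the point mass at \<open>w\<close> in the role of \<open>g\<^bsub>N-1\<^esub>\<close>.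
  Averaging over one more return yields \<open>D\<^sub>t(x) = \<integral> g\<^sub>t(k) P\<^sub>t(k | x) dk\<close> for \<open>x > 0\<close>.
\<close>

section \<open>Return densities\<close>

definition put_payoff_mean :: "real measure \<Rightarrow> real \<Rightarrow> real" where
  "put_payoff_mean \<mu> K = (\<integral>x. max (K - x) 0 \<partial>\<mu>)"

lemma integrable_put_payoff:
  assumes "prob_space \<mu>" "sets \<mu> = sets borel" "AE x in \<mu>. 0 < x"
  shows "integrable \<mu> (\<lambda>x. max (K - x) (0::real))"
proof -
  interpret prob_space \<mu> by fact
  show ?thesis
  proof (rule integrable_const_bound[where B="\<bar>K\<bar>"])
    show "AE x in \<mu>. norm (max (K - x) 0) \<le> \<bar>K\<bar>" using assms(3) by eventually_elim auto
    show "(\<lambda>x. max (K - x) 0) \<in> borel_measurable \<mu>"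
      using assms(2) by (simp add: measurable_cong_sets[OF assms(2) refl])
  qed
qed

text \<open>The payoff quotients are bounded by 1 and tend pointwise to the indicator of
  \<open>{..K}\<close>. The increments of the strike are positive, so the point \<open>K\<close>
  itself counts, in agreement with the right-continuous \<open>cdf\<close>.\<close>

lemma put_payoff_mean_quotient_tendsto_cdf:
  assumes "prob_space \<mu>" "sets \<mu> = sets borel" "AE x in \<mu>. 0 < x"
  shows "(\<lambda>n. (put_payoff_mean \<mu> (K + inverse (real (Suc n))) - put_payoff_mean \<mu> K) /
               inverse (real (Suc n))) \<longlonglongrightarrow> cdf \<mu> K"
proof -
  interpret prob_space \<mu> by fact
  note [measurable_cong] = assms(2)
  define h where "h n = inverse (real (Suc n))" for n
  have h: "h n > 0" for n by (simp add: h_def)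
  have hlim: "h \<longlonglongrightarrow> 0" unfolding h_def by (rule LIMSEQ_inverse_real_of_nat)
  define q where "q n x = (max (K + h n - x) 0 - max (K - x) 0) / h n" for n x
  have eq: "(put_payoff_mean \<mu> (K + h n) - put_payoff_mean \<mu> K) / h n = (\<integral>x. q n x \<partial>\<mu>)" for n
    unfolding put_payoff_mean_def q_def
    using integrable_put_payoff[OF assms] by simp
  have "(\<lambda>n. \<integral>x. q n x \<partial>\<mu>) \<longlonglongrightarrow> (\<integral>x. indicator {..K} x \<partial>\<mu>)"
  proof (rule integral_dominated_convergence[where w="\<lambda>_. 1"])
    show "AE x in \<mu>. (\<lambda>n. q n x) \<longlonglongrightarrow> indicator {..K} x"
    proof (rule AE_I2)
      fix x
      show "(\<lambda>n. q n x) \<longlonglongrightarrow> indicator {..K} x"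
      proof (cases "x \<le> K")
        case True
        have "q n x = 1" for n using True h[of n] by (simp add: q_def)
        then show ?thesis using True by simp
      next
        case False
        then have "eventually (\<lambda>n. h n < x - K) sequentially"
          using order_tendstoD(2)[OF hlim, of "x - K"] by simp
        then have "eventually (\<lambda>n. q n x = 0) sequentially"
          by eventually_elim (use False in \<open>simp add: q_def\<close>)
        then show ?thesis using False by (simp add: tendsto_eventually)
      qed
    qed
    show "AE x in \<mu>. norm (q n x) \<le> 1" for n
      using h[of n] by (intro AE_I2) (auto simp: q_def divide_simps max_def)
  qed (auto simp: q_def)
  also have "(\<integral>x. indicator {..K} x \<partial>\<mu>) = cdf \<mu> K"
    by (simp add: cdf_def sets_eq_imp_space_eq[OF assms(2)])
  finally show ?thesis unfolding eq[symmetric] unfolding h_def .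
qed

text \<open>A derivative, once it exists, must agree with the limit of the forward quotients along
  the increments \<open>1 / (n + 1)\<close>.\<close>

lemma put_payoff_mean_has_derivative_cdf:
  assumes "prob_space \<mu>" "sets \<mu> = sets borel" "AE x in \<mu>. 0 < x"
    and "put_payoff_mean \<mu> differentiable (at K)"
  shows "(put_payoff_mean \<mu> has_real_derivative cdf \<mu> K) (at K)"
proof -
  obtain D where D: "(put_payoff_mean \<mu> has_real_derivative D) (at K)"
    using assms(4) real_differentiable_def by blast
  have "((\<lambda>h. (put_payoff_mean \<mu> (K + h) - put_payoff_mean \<mu> K) / h) \<longlongrightarrow> D) (at 0)"
    using D by (simp add: DERIV_def)
  moreover have "filterlim (\<lambda>n. inverse (real (Suc n))) (at 0) sequentially"
    by (intro filterlim_atI LIMSEQ_inverse_real_of_nat) auto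
  ultimately have "(\<lambda>n. (put_payoff_mean \<mu> (K + inverse (real (Suc n))) - put_payoff_mean \<mu> K) /
               inverse (real (Suc n))) \<longlonglongrightarrow> D"
    by (rule filterlim_compose)
  with put_payoff_mean_quotient_tendsto_cdf[OF assms(1-3)] have "D = cdf \<mu> K"
    by (blast intro: LIMSEQ_unique)
  with D show ?thesis by simp
qed

lemma cdf_eq_0_of_AE_pos:
  assumes "sets \<mu> = sets borel" "AE x in \<mu>. (0::real) < x" "K \<le> 0"
  shows "cdf \<mu> K = 0"
proof -
  have "emeasure \<mu> {..K} = 0"
    using assms by (subst AE_iff_measurable[symmetric, where P="\<lambda>x. \<not> x \<le> K"])
      (auto simp: sets_eq_imp_space_eq[OF assms(1)])
  then show ?thesis by (simp add: cdf_def measure_def)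
qed

text \<open>The forward quotients recover the distribution function at \<open>K\<close> from put
  prices at \<open>K\<close> and slightly higher strikes. For \<open>K > 0\<close> these strikes are
  all positive, and elsewhere both distribution functions vanish.\<close>

lemma measure_eqI_put_payoff_mean:
  assumes "prob_space \<mu>" "sets \<mu> = sets borel" "AE x in \<mu>. 0 < x"
    and "prob_space \<nu>" "sets \<nu> = sets borel" "AE x in \<nu>. 0 < x"
    and "\<And>K. K > 0 \<Longrightarrow> put_payoff_mean \<mu> K = put_payoff_mean \<nu> K"
  shows "\<mu> = \<nu>"
proof (rule cdf_unique)
  show "real_distribution \<mu>" "real_distribution \<nu>"
    using assms by (auto simp: real_distribution_def real_distribution_axioms_def)
  show "cdf \<mu> = cdf \<nu>"
  proof
    fix K :: real
    show "cdf \<mu> K = cdf \<nu> K"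
    proof (cases "K > 0")
      case False
      then show ?thesis using cdf_eq_0_of_AE_pos assms by simp
    next
      case True
      then have "K + inverse (real (Suc n)) > 0" for n by (simp add: add_pos_pos)
      then show ?thesis
        using put_payoff_mean_quotient_tendsto_cdf[OF assms(1-3), of K]
          put_payoff_mean_quotient_tendsto_cdf[OF assms(4-6), of K] True assms(7)
        by (auto intro: LIMSEQ_unique)
    qed
  qed
qed

text \<open>The derivative \<open>g\<close> need not be continuous, so the fundamental theorem of
  calculus is applied in its gauge integral form. Monotonicity of the distribution function makes
  \<open>g\<close> nonnegative, which turns the gauge integral into a Lebesgue integral.\<close>

lemma density_of_differentiable_cdf:
  assumes "prob_space \<nu>" "sets \<nu> = sets borel" "AE x in \<nu>. (0::real) < x"
    and deriv: "\<And>x. x > 0 \<Longrightarrow> (cdf \<nu> has_real_derivative g x) (at x)"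
  shows "\<exists>f. f \<in> borel_measurable borel \<and> (\<forall>x. 0 \<le> f x) \<and> (\<forall>x\<le>0. f x = 0) \<and>
             (\<forall>x>0. f x = g x) \<and> \<nu> = density lborel (\<lambda>x. ennreal (f x))"
proof -
  interpret real_distribution \<nu>
    using assms by (auto simp: real_distribution_def real_distribution_axioms_def)
  define h where "h n = inverse (real (Suc n))" for n
  define f where "f x = (if x > 0 then g x else 0)" for x
  have cdf_meas[measurable]: "cdf \<nu> \<in> borel_measurable borel"
    by (rule borel_measurable_mono) (simp add: mono_def cdf_nondecreasing)
  \<comment> \<open>Difference quotients of a monotone function are measurable and nonnegative, and
    both properties pass to the limit \<open>f\<close>.\<close>
  have lim: "(\<lambda>n. (if x > 0 then (cdf \<nu> (x + h n) - cdf \<nu> x) / h n else 0)) \<longlonglongrightarrow> f x" for x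
  proof (cases "x > 0")
    case True
    have "((\<lambda>h. (cdf \<nu> (x + h) - cdf \<nu> x) / h) \<longlongrightarrow> g x) (at 0)"
      using deriv[OF True] by (simp add: DERIV_def)
    moreover have "filterlim h (at 0) sequentially"
      unfolding h_def by (intro filterlim_atI LIMSEQ_inverse_real_of_nat) auto
    ultimately have "(\<lambda>n. (cdf \<nu> (x + h n) - cdf \<nu> x) / h n) \<longlonglongrightarrow> g x"
      by (rule filterlim_compose)
    then show ?thesis using True by (simp add: f_def)
  qed (simp add: f_def)
  have f_meas[measurable]: "f \<in> borel_measurable borel"
    by (rule borel_measurable_LIMSEQ_real[OF lim]) measurable
  have f0: "f x \<ge> 0" for x
  proof -
    have "0 \<le> (if x > 0 then (cdf \<nu> (x + h n) - cdf \<nu> x) / h n else 0)" for n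
      by (simp add: h_def cdf_nondecreasing)
    then show ?thesis using LIMSEQ_le_const[OF lim[of x]] by auto
  qed
  have cdf_f: "(\<integral>\<^sup>+x. ennreal (f x) * indicator {..K} x \<partial>lborel) = ennreal (cdf \<nu> K)" for K
  proof (cases "K \<ge> 0")
    case False
    then have "(\<integral>\<^sup>+x. ennreal (f x) * indicator {..K} x \<partial>lborel) = (\<integral>\<^sup>+x. 0 \<partial>(lborel :: real measure))"
      by (intro nn_integral_cong) (auto simp: f_def indicator_def)
    then show ?thesis using cdf_eq_0_of_AE_pos[OF assms(2,3), of K] False by simp
  next
    case True
    \<comment> \<open>The derivative is available only in the interior. At the left endpoint 0 the
      right-continuity of \<open>cdf\<close> supplies the required continuity.\<close>
    have "((g) has_integral (cdf \<nu> K - cdf \<nu> 0)) {0..K}"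
    proof (rule fundamental_theorem_of_calculus_interior[OF True])
      show "continuous_on {0..K} (cdf \<nu>)"
        unfolding continuous_on_eq_continuous_within
      proof
        fix x assume x: "x \<in> {0..K}"
        show "continuous (at x within {0..K}) (cdf \<nu>)"
        proof (cases "x = 0")
          case True
          have "continuous (at x within {x..}) (cdf \<nu>)"
            using cdf_is_right_cont[of x] unfolding continuous_within at_within_Ici_at_right by simp
          then show ?thesis using True by (auto intro: continuous_within_subset)
        next
          case False
          then show ?thesis using deriv[of x] x
            by (auto intro: continuous_at_imp_continuous_at_within DERIV_isCont)
        qed
      qed
      show "(cdf \<nu> has_vector_derivative g x) (at x)" if "x \<in> {0<..<K}" for x
        using deriv[of x] that by (simp add: has_real_derivative_iff_has_vector_derivative)
    qed
    then have "(f has_integral (cdf \<nu> K - cdf \<nu> 0)) {0..K}"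
      by (rule has_integral_spike_finite[of "{0}", rotated 2]) (auto simp: f_def)
    from nn_integral_has_integral_lebesgue'[OF f0 this]
    have "(\<integral>\<^sup>+x. ennreal (f x) * indicator {0..K} x \<partial>lborel) = ennreal (cdf \<nu> K)"
      using cdf_eq_0_of_AE_pos[OF assms(2,3), of 0] by simp
    moreover have "(\<integral>\<^sup>+x. ennreal (f x) * indicator {0..K} x \<partial>lborel) =
        (\<integral>\<^sup>+x. ennreal (f x) * indicator {..K} x \<partial>lborel)"
      by (intro nn_integral_cong) (auto simp: f_def indicator_def)
    ultimately show ?thesis by simp
  qed
  have "\<nu> = density lborel (\<lambda>x. ennreal (f x))"
  proof -
    let ?D = "density lborel (\<lambda>x. ennreal (f x))"
    have em: "emeasure ?D {..K} = ennreal (cdf \<nu> K)" for K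
      using cdf_f[of K] by (simp add: emeasure_density)
    \<comment> \<open>Total mass 1 must be known before the two measures can be compared through
      their distribution functions; it is the limit of \<open>cdf\<close> at infinity.\<close>
    have "(\<lambda>n. emeasure ?D {..real n}) \<longlonglongrightarrow> emeasure ?D (\<Union>n. {..real n})"
      by (rule Lim_emeasure_incseq) (auto simp: incseq_def)
    moreover have "(\<Union>n. {..real n}) = UNIV" by (auto simp: real_arch_simple)
    moreover have "(\<lambda>n. ennreal (cdf \<nu> (real n))) \<longlonglongrightarrow> ennreal 1"
      using cdf_lim_infty_prob by (intro tendsto_intros)
    ultimately have "emeasure ?D UNIV = 1" using em LIMSEQ_unique by (auto simp: LIMSEQ_unique)
    then interpret D: prob_space ?D by (intro prob_spaceI) simp
    show ?thesis
    proof (rule cdf_unique)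
      show "real_distribution \<nu>" by unfold_locales
      show "real_distribution ?D" by unfold_locales simp_all
      show "cdf \<nu> = cdf ?D"
        using em cdf_nonneg by (auto simp: cdf_def[of ?D] measure_def)
    qed
  qed
  then show ?thesis using f_meas f0 by (intro exI[of _ f]) (auto simp: f_def)
qed

section \<open>Substitution of the return for the spot\<close>

lemma nn_integral_subst_divide:
  fixes h :: "real \<Rightarrow> real"
  assumes K: "K > 0" and h: "h \<in> borel_measurable borel" "\<And>x. 0 \<le> h x"
    and fin: "(\<integral>\<^sup>+x. ennreal (h x) * indicator {0<..} x \<partial>lborel) < \<infinity>"
  shows "(\<integral>\<^sup>+s. ennreal (K / s\<^sup>2 * h (K / s)) * indicator {0<..} s \<partial>lborel) =
         (\<integral>\<^sup>+x. ennreal (h x) * indicator {0<..} x \<partial>lborel)"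
proof -
  note [measurable] = h(1)
  have "integrable lborel (\<lambda>x. indicator {0<..} x *\<^sub>R h x)"
  proof (rule integrableI_nonneg)
    have "(\<integral>\<^sup>+x. ennreal (indicator {0<..} x *\<^sub>R h x) \<partial>lborel) =
        (\<integral>\<^sup>+x. ennreal (h x) * indicator {0<..} x \<partial>lborel)"
      by (intro nn_integral_cong) (auto simp: indicator_def)
    then show "(\<integral>\<^sup>+x. ennreal (indicator {0<..} x *\<^sub>R h x) \<partial>lborel) < \<infinity>" using fin by simp
  qed (use h in auto)
  then have abs1: "h absolutely_integrable_on {0<..}"
    unfolding set_integrable_def by (subst integrable_completion) auto
  have img: "(\<lambda>s. K / s) ` {0<..} = {0<..}"
  proof safe
    fix x :: real assume "0 < x"
    then have "x = K / (K / x)" "K / x \<in> {0<..}" using K by auto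
    then show "x \<in> (\<lambda>s. K / s) ` {0<..}" by blast
  qed (use K in auto)
  \<comment> \<open>The map sending \<open>s\<close> to \<open>K / s\<close> is a bijection of the
    positive reals, with this Jacobian. The change of variables theorem concerns absolutely
    integrable functions, which is where \<open>fin\<close> enters.\<close>
  let ?g = "\<lambda>s. \<bar>- K / s\<^sup>2\<bar> * h (K / s)"
  have "?g absolutely_integrable_on {0<..} \<and> integral {0<..} ?g = integral {0<..} h"
  proof (rule has_absolute_integral_change_of_variables_1'[where S="{0<..}" and g="(/) K", THEN iffD2])
    show "((/) K has_real_derivative - K / x\<^sup>2) (at x within {0<..})" if "x \<in> {0<..}" for x
      using that by (auto intro!: derivative_eq_intros simp: power2_eq_square)
    show "inj_on ((/) K) {0<..}" using K by (auto simp: inj_on_def)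
  qed (use abs1 img in auto)
  then have g: "(?g has_integral integral {0<..} h) {0<..}"
    using has_integral_integral set_lebesgue_integral_eq_integral(1) by metis
  have hh: "(h has_integral integral {0<..} h) {0<..}"
    using abs1 has_integral_integral set_lebesgue_integral_eq_integral(1) by blast
  have "(\<integral>\<^sup>+s. ennreal (K / s\<^sup>2 * h (K / s)) * indicator {0<..} s \<partial>lborel) =
      (\<integral>\<^sup>+s. ennreal (?g s) * indicator {0<..} s \<partial>lborel)"
    using K by (intro nn_integral_cong) (auto simp: abs_mult)
  also have "\<dots> = ennreal (integral {0<..} h)"
    by (rule nn_integral_has_integral_lebesgue'[OF _ g]) (use h in auto)
  also have "\<dots> = (\<integral>\<^sup>+x. ennreal (h x) * indicator {0<..} x \<partial>lborel)"
    by (rule nn_integral_has_integral_lebesgue'[OF _ hh, symmetric]) (use h in auto)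
  finally show ?thesis .
qed

text \<open>With \<open>r = K / s\<close> the product \<open>K / s * (s - y)\<close> is
  \<open>K - y * r\<close>, so a call payoff in the spot becomes a put payoff in the return, and the
  remaining factor \<open>K / s\<^sup>2\<close> is the Jacobian.\<close>

lemma nn_integral_gamma_call:
  fixes f :: "real \<Rightarrow> real"
  assumes "K > 0" and f[measurable]: "f \<in> borel_measurable borel" and f0: "\<And>x. 0 \<le> f x" "\<And>x. x \<le> 0 \<Longrightarrow> f x = 0"
    and \<nu>: "\<nu> = density lborel (\<lambda>x. ennreal (f x))" and "prob_space \<nu>"
    and mean: "(\<integral>\<^sup>+r. ennreal r \<partial>\<nu>) = 1"
  shows "(\<integral>\<^sup>+s. ennreal (K\<^sup>2 / s ^ 3 * f (K / s) * max (s - y) 0) * indicator {0<..} s \<partial>lborel) =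
         (\<integral>\<^sup>+r. ennreal (max (K - y * r) 0) \<partial>\<nu>)"
proof -
  interpret prob_space \<nu> by fact
  define h where "h r = f r * max (K - y * r) 0" for r
  have [measurable]: "h \<in> borel_measurable borel" unfolding h_def by measurable
  have h0: "h r \<ge> 0" for r using f0 by (simp add: h_def)
  have eq: "(\<integral>\<^sup>+r. ennreal (max (K - y * r) 0) \<partial>\<nu>) = (\<integral>\<^sup>+x. ennreal (h x) * indicator {0<..} x \<partial>lborel)"
    unfolding \<nu> by (subst nn_integral_density)
      (auto intro!: nn_integral_cong simp: h_def f0 indicator_def ennreal_mult)
  \<comment> \<open>For negative \<open>y\<close> the payoff is unbounded in \<open>r\<close>; the
    finite mean supplies the finiteness that the substitution requires.\<close>
  have "(\<integral>\<^sup>+r. ennreal (max (K - y * r) 0) \<partial>\<nu>) \<le> (\<integral>\<^sup>+r. ennreal K + ennreal \<bar>y\<bar> * ennreal r \<partial>\<nu>)"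
  proof (rule nn_integral_mono_AE)
    have "AE r in \<nu>. 0 < r"
      unfolding \<nu> by (subst AE_density) (auto intro!: AE_I2 dest: f0(2) simp: not_le[symmetric])
    then show "AE r in \<nu>. ennreal (max (K - y * r) 0) \<le> ennreal K + ennreal \<bar>y\<bar> * ennreal r"
    proof eventually_elim
      fix r :: real assume r: "0 < r"
      have "- y * r \<le> \<bar>y\<bar> * r" using r by (intro mult_right_mono) auto
      then have "max (K - y * r) 0 \<le> K + \<bar>y\<bar> * r" using r \<open>K > 0\<close> by auto
      then show "ennreal (max (K - y * r) 0) \<le> ennreal K + ennreal \<bar>y\<bar> * ennreal r"
        using r \<open>K > 0\<close> by (simp flip: ennreal_mult ennreal_plus add: ennreal_leI)
    qed
  qed
  also have "\<dots> = ennreal K + ennreal \<bar>y\<bar>"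
    unfolding \<nu> by (subst nn_integral_add, simp_all, subst nn_integral_cmult, simp_all)
      (use mean emeasure_space_1 in \<open>simp_all add: \<nu>\<close>)
  also have "\<dots> < \<infinity>" by simp
  finally have fin: "(\<integral>\<^sup>+x. ennreal (h x) * indicator {0<..} x \<partial>lborel) < \<infinity>" unfolding eq .
  have "(\<integral>\<^sup>+s. ennreal (K\<^sup>2 / s ^ 3 * f (K / s) * max (s - y) 0) * indicator {0<..} s \<partial>lborel) =
      (\<integral>\<^sup>+s. ennreal (K / s\<^sup>2 * h (K / s)) * indicator {0<..} s \<partial>lborel)"
  proof (intro nn_integral_cong)
    fix s :: real
    have "K\<^sup>2 / s ^ 3 * f (K / s) * max (s - y) 0 = K / s\<^sup>2 * h (K / s)" if s: "s > 0"
    proof -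
      have "max (K - y * (K / s)) 0 = max (K / s * (s - y)) (K / s * 0)"
        using s by (simp add: field_simps)
      also have "\<dots> = K / s * max (s - y) 0"
        using s \<open>K > 0\<close> max_mult_distrib_left[of "K / s" "s - y" 0] by (metis divide_pos_pos less_imp_le)
      finally show ?thesis using s by (simp add: h_def field_simps power2_eq_square power3_eq_cube)
    qed
    then show "ennreal (K\<^sup>2 / s ^ 3 * f (K / s) * max (s - y) 0) * indicator {0<..} s =
        ennreal (K / s\<^sup>2 * h (K / s)) * indicator {0<..} s"
      by (auto simp: indicator_def)
  qed
  also have "\<dots> = (\<integral>\<^sup>+x. ennreal (h x) * indicator {0<..} x \<partial>lborel)"
    by (rule nn_integral_subst_divide) (use \<open>K > 0\<close> h0 fin in auto)
  finally show ?thesis using eq by simp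
qed

section \<open>Transition kernels with homogeneous put prices\<close>

lemma markov_kernel:
  assumes "markov_with_kernels N M F S \<kappa>" "t < N" "s > 0"
  shows "prob_space (\<kappa> t s)" "sets (\<kappa> t s) = sets borel" "AE x in \<kappa> t s. 0 < x"
proof -
  have "\<kappa> t \<in> measurable (restrict_space borel {0<..}) (prob_algebra borel)"
    using assms unfolding markov_with_kernels_def by blast
  then have "\<kappa> t s \<in> space (prob_algebra borel)"
    by (rule measurable_space) (use assms(3) in \<open>simp add: space_restrict_space\<close>)
  then show "prob_space (\<kappa> t s)" "sets (\<kappa> t s) = sets borel" by (auto simp: space_prob_algebra)
  show "AE x in \<kappa> t s. 0 < x"
    using assms unfolding markov_with_kernels_def by blast
qed

lemma independent_returnsD:
  assumes "independent_returns N \<kappa>" "t < N" "\<alpha> > 0" "K > 0" "s > 0"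
  shows "put_price \<kappa> t (\<alpha> * K) (\<alpha> * s) = \<alpha> * put_price \<kappa> t K s"
  using assms unfolding independent_returns_def by blast

text \<open>Scaling the law at spot 1 by \<open>s\<close> gives the put price
  \<open>s * put_price \<kappa> t (K / s) 1\<close>, which by homogeneity is the price at spot
  \<open>s\<close>. A law on the positive reals is determined by its put prices.\<close>

lemma independent_returns_kernel:
  assumes mk: "markov_with_kernels N M F S \<kappa>" and "independent_returns N \<kappa>" "t < N" "s > 0"
  shows "\<kappa> t s = distr (\<kappa> t 1) borel (\<lambda>r. s * r)"
proof (rule measure_eqI_put_payoff_mean)
  note k1 = markov_kernel[OF mk \<open>t < N\<close> zero_less_one]
  note [measurable_cong] = k1(2)
  show "prob_space (\<kappa> t s)" "sets (\<kappa> t s) = sets borel" "AE x in \<kappa> t s. 0 < x"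
    using markov_kernel[OF mk] assms by auto
  interpret prob_space "\<kappa> t 1" by (rule k1)
  show "prob_space (distr (\<kappa> t 1) borel (\<lambda>r. s * r))" by (rule prob_space_distr) measurable
  show "AE x in distr (\<kappa> t 1) borel (\<lambda>r. s * r). 0 < x"
    using k1(3) \<open>s > 0\<close> by (subst AE_distr_iff) (auto simp: zero_less_mult_iff)
  fix K :: real assume "K > 0"
  have "put_payoff_mean (distr (\<kappa> t 1) borel (\<lambda>r. s * r)) K = (\<integral>r. max (K - s * r) 0 \<partial>\<kappa> t 1)"
    unfolding put_payoff_mean_def by (subst integral_distr) auto
  also have "\<dots> = (\<integral>r. s * max (K / s - r) 0 \<partial>\<kappa> t 1)"
    using \<open>s > 0\<close> by (intro Bochner_Integration.integral_cong) (auto simp: max_def field_simps)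
  also have "\<dots> = s * put_price \<kappa> t (K / s) 1" by (simp add: put_price_def)
  also have "\<dots> = put_price \<kappa> t (s * (K / s)) (s * 1)"
    using assms \<open>K > 0\<close> by (intro independent_returnsD[symmetric]) auto
  also have "\<dots> = put_payoff_mean (\<kappa> t s) K" using \<open>s > 0\<close> by (simp add: put_price_def put_payoff_mean_def)
  finally show "put_payoff_mean (\<kappa> t s) K = put_payoff_mean (distr (\<kappa> t 1) borel (\<lambda>r. s * r)) K" ..
qed simp

text \<open>Homogeneity writes the price as \<open>s * p (K / s)\<close>, where \<open>p\<close> is
  the price at spot 1, with first derivative the \<open>cdf\<close> of the return and second
  derivative \<open>f\<close>. In the second derivative with respect to \<open>s\<close> the two
  \<open>cdf\<close> terms cancel and only the term with \<open>f\<close> remains.\<close>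

lemma put_gamma_return_density:
  assumes rm: "regular_markov N M F S \<kappa>" and ir: "independent_returns N \<kappa>" and t: "t < N"
  shows "\<exists>f. f \<in> borel_measurable borel \<and> (\<forall>x. 0 \<le> f x) \<and> (\<forall>x\<le>0. f x = 0) \<and>
     \<kappa> t 1 = density lborel (\<lambda>x. ennreal (f x)) \<and>
     (\<forall>K>0. \<forall>s>0. put_gamma \<kappa> t K s = K\<^sup>2 / s ^ 3 * f (K / s))"
proof -
  have mk: "markov_with_kernels N M F S \<kappa>" using rm by (simp add: regular_markov_def)
  note k1 = markov_kernel[OF mk t zero_less_one]
  let ?p = "put_payoff_mean (\<kappa> t 1)"
  have p: "(\<lambda>K. put_price \<kappa> t K 1) = ?p" by (rule ext) (simp add: put_price_def put_payoff_mean_def)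
  have "twice_differentiable_on ?p {0<..}"
    using rm t unfolding regular_markov_def p[symmetric] by simp
  then have d1: "?p differentiable_on {0<..}" and d2: "deriv ?p differentiable_on {0<..}"
    by (auto simp: twice_differentiable_on_def)
  have D1: "(?p has_real_derivative cdf (\<kappa> t 1) x) (at x)" if "x > 0" for x
  proof (rule put_payoff_mean_has_derivative_cdf[OF k1])
    show "?p differentiable at x"
      using d1 that by (simp add: differentiable_on_eq_differentiable_at)
  qed
  have dp: "deriv ?p x = cdf (\<kappa> t 1) x" if "x > 0" for x
    using D1[OF that] by (rule DERIV_imp_deriv)
  define g where "g x = deriv (deriv ?p) x" for x
  have D2: "(cdf (\<kappa> t 1) has_real_derivative g x) (at x)" if "x > 0" for x
  proof -
    have "(deriv ?p has_real_derivative g x) (at x)"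
      unfolding g_def using d2 that
      by (simp add: differentiable_on_eq_differentiable_at DERIV_deriv_iff_real_differentiable)
    then show ?thesis
      by (rule DERIV_cong_ev[OF refl _ refl, THEN iffD1, rotated])
        (use eventually_nhds_in_open[of "{0<..}" x] that in \<open>auto elim!: eventually_mono simp: dp\<close>)
  qed
  \<comment> \<open>The density equals the second derivative at every positive point, not just
    almost everywhere; this makes the formula for \<open>put_gamma\<close> valid for all
    \<open>K\<close> and \<open>s\<close>.\<close>
  obtain f where f: "f \<in> borel_measurable borel" "\<forall>x. 0 \<le> f x" "\<forall>x\<le>0. f x = 0" "\<forall>x>0. f x = g x"
     "\<kappa> t 1 = density lborel (\<lambda>x. ennreal (f x))"
    using density_of_differentiable_cdf[OF k1 D2] by blast
  have "put_gamma \<kappa> t K s = K\<^sup>2 / s ^ 3 * f (K / s)" if K: "K > 0" and s: "s > 0" for K s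
  proof -
    have pp: "put_price \<kappa> t K u = u * ?p (K / u)" if "u > 0" for u
    proof -
      have "put_price \<kappa> t (u * (K / u)) (u * 1) = u * put_price \<kappa> t (K / u) 1"
        using ir t K that by (intro independent_returnsD) auto
      then show ?thesis using that fun_cong[OF p, of "K / u"] by simp
    qed
    have "(put_price \<kappa> t K has_real_derivative ?p (K / u) - K / u * cdf (\<kappa> t 1) (K / u)) (at u)"
      if u: "u > 0" for u
    proof -
      have "((\<lambda>u. u * ?p (K / u)) has_real_derivative
          ?p (K / u) - K / u * cdf (\<kappa> t 1) (K / u)) (at u)"
        using u K by (auto intro!: derivative_eq_intros DERIV_chain2[OF D1] simp: field_simps power2_eq_square)
      then show ?thesis
        by (rule DERIV_cong_ev[OF refl _ refl, THEN iffD1, rotated])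
          (use eventually_nhds_in_open[of "{0<..}" u] u in \<open>auto elim!: eventually_mono simp: pp\<close>)
    qed
    then have dput: "deriv (put_price \<kappa> t K) u = ?p (K / u) - K / u * cdf (\<kappa> t 1) (K / u)" if "u > 0" for u
      using that by (intro DERIV_imp_deriv) auto
    have "((\<lambda>u. ?p (K / u) - K / u * cdf (\<kappa> t 1) (K / u)) has_real_derivative K\<^sup>2 / s ^ 3 * f (K / s)) (at s)"
      using s K f(4) by (auto intro!: derivative_eq_intros DERIV_chain2[OF D1] DERIV_chain2[OF D2]
          simp: field_simps power2_eq_square power3_eq_cube)
    then have "(deriv (put_price \<kappa> t K) has_real_derivative K\<^sup>2 / s ^ 3 * f (K / s)) (at s)"
      by (rule DERIV_cong_ev[OF refl _ refl, THEN iffD1, rotated])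
        (use eventually_nhds_in_open[of "{0<..}" s] s in \<open>auto elim!: eventually_mono simp: dput\<close>)
    then show ?thesis unfolding put_gamma_def by (rule DERIV_imp_deriv)
  qed
  with f show ?thesis by blast
qed

section \<open>Claim values as mixtures of puts\<close>

text \<open>
  The last two arguments are the number \<open>j\<close> of remaining withdrawals and the fund value \<open>x\<close>
  at time \<open>N - j\<close>, no depletion having occurred before; \<open>\<nu> t\<close> is the law of the return from
  \<open>t\<close> to \<open>t + 1\<close>.
\<close>

primrec claim_value :: "(nat \<Rightarrow> real measure) \<Rightarrow> nat \<Rightarrow> real \<Rightarrow> nat \<Rightarrow> real \<Rightarrow> ennreal" where
  "claim_value \<nu> N w 0 x = ennreal (- x)"
| "claim_value \<nu> N w (Suc j) x =
     (if x \<le> 0 then ennreal (real (Suc j) * w - x)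
      else \<integral>\<^sup>+r. claim_value \<nu> N w j (x * r - w) \<partial>\<nu> (N - Suc j))"

lemma claim_value_depleted: "x \<le> 0 \<Longrightarrow> claim_value \<nu> N w j x = ennreal (real j * w - x)"
  by (cases j) auto

text \<open>Separates the deterministic induction on the weights from the underlying probability
  space. Mean and put prices are phrased as extended nonnegative integrals so that Tonelli's theorem
  applies without integrability conditions.\<close>

locale return_model =
  fixes N :: nat and w :: real and \<kappa> :: "nat \<Rightarrow> real \<Rightarrow> real measure" and f :: "nat \<Rightarrow> real \<Rightarrow> real"
  assumes N: "N > 0" and w: "w > 0"
    and f_measurable: "\<And>t. t < N \<Longrightarrow> f t \<in> borel_measurable borel"
    and f_nonneg: "\<And>t x. t < N \<Longrightarrow> 0 \<le> f t x"
    and f_eq_0: "\<And>t x. t < N \<Longrightarrow> x \<le> 0 \<Longrightarrow> f t x = 0"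
    and prob_return: "\<And>t. t < N \<Longrightarrow> prob_space (\<kappa> t 1)"
    and return_density: "\<And>t. t < N \<Longrightarrow> \<kappa> t 1 = density lborel (\<lambda>x. ennreal (f t x))"
    and return_mean: "\<And>t. t < N \<Longrightarrow> (\<integral>\<^sup>+r. ennreal r \<partial>\<kappa> t 1) = 1"
    and gamma_eq: "\<And>t K s. t < N \<Longrightarrow> K > 0 \<Longrightarrow> s > 0 \<Longrightarrow> put_gamma \<kappa> t K s = K\<^sup>2 / s ^ 3 * f t (K / s)"
    and put_eq: "\<And>t K s. t < N \<Longrightarrow> K > 0 \<Longrightarrow> s > 0 \<Longrightarrow>
        ennreal (put_price \<kappa> t K s) = (\<integral>\<^sup>+r. ennreal (max (K - s * r) 0) \<partial>\<kappa> t 1)"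
begin

abbreviation D :: "nat \<Rightarrow> real \<Rightarrow> ennreal" where
  "D \<equiv> claim_value (\<lambda>t. \<kappa> t 1) N w"

lemma sets_return[measurable_cong]: "t < N \<Longrightarrow> sets (\<kappa> t 1) = sets borel"
  by (simp add: return_density)

lemma return_pos: "t < N \<Longrightarrow> AE r in \<kappa> t 1. 0 < r"
  using f_measurable[of t] by (subst return_density, simp, subst AE_density)
    (auto intro!: AE_I2 simp: not_le[symmetric] f_eq_0)

lemma claim_value_measurable[measurable]: "D j \<in> borel_measurable borel"
proof (induction j)
  case (Suc j)
  note [measurable] = Suc
  have t: "N - Suc j < N" using N by simp
  interpret prob_space "\<kappa> (N - Suc j) 1" by (rule prob_return[OF t])
  note [measurable_cong] = sets_return[OF t]
  show ?case by simp
qed simp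

text \<open>\<open>\<mu>\<close> is the second derivative of \<open>y \<mapsto> D j (y - w)\<close>.\<close>

definition represents :: "real measure \<Rightarrow> nat \<Rightarrow> bool" where
  "represents \<mu> j \<longleftrightarrow> sets \<mu> = sets borel \<and> (AE k in \<mu>. w \<le> k) \<and>
     (\<forall>y. (\<integral>\<^sup>+k. ennreal (max (k - y) 0) \<partial>\<mu>) = D j (y - w))"

text \<open>The payoff with \<open>y = w - 1\<close> is at least 1 wherever \<mu> has mass, and its
  integral is the value of a depleted fund at -1, which is finite. Finiteness is what the later uses
  of Tonelli's theorem rest on.\<close>

lemma represents_finite_measure:
  assumes "represents \<mu> j"
  shows "finite_measure \<mu>"
proof
  note [measurable_cong] = assms[unfolded represents_def, THEN conjunct1]
  have "emeasure \<mu> (space \<mu>) = (\<integral>\<^sup>+k. 1 \<partial>\<mu>)" by simp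
  also have "\<dots> \<le> (\<integral>\<^sup>+k. ennreal (max (k - (w - 1)) 0) \<partial>\<mu>)"
  proof (rule nn_integral_mono_AE)
    show "AE k in \<mu>. 1 \<le> ennreal (max (k - (w - 1)) 0)"
      using assms unfolding represents_def by (auto elim!: eventually_mono simp flip: ennreal_1 intro!: ennreal_leI)
  qed
  also have "\<dots> = ennreal (real j * w + 1)"
    using assms unfolding represents_def by (simp add: claim_value_depleted)
  finally show "emeasure \<mu> (space \<mu>) \<noteq> \<infinity>" by (auto simp: top_unique)
qed

text \<open>With no withdrawal left, the claim is the shortfall \<open>w - y\<close> cut off at 0 by
  \<open>ennreal\<close>, which is the payoff of a single strike at \<open>w\<close>.\<close>

lemma represents_return: "represents (return borel w) 0"
  unfolding represents_def
  by (auto simp: AE_return nn_integral_return max_def ennreal_neg)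

text \<open>The representation is applied at \<open>y = x * r\<close> under the integral over the
  next return \<open>r\<close>; exchanging the integrals leaves a mixture of puts on the
  fund.\<close>

lemma claim_value_Suc_eq_puts:
  assumes \<mu>: "represents \<mu> j" and t: "t = N - Suc j" and x: "x > 0"
  shows "D (Suc j) x = (\<integral>\<^sup>+k. \<integral>\<^sup>+r. ennreal (max (k - x * r) 0) \<partial>\<kappa> t 1 \<partial>\<mu>)"
proof -
  have tN: "t < N" using N t by simp
  interpret \<mu>: finite_measure \<mu> using \<mu> by (rule represents_finite_measure)
  interpret \<nu>: prob_space "\<kappa> t 1" by (rule prob_return[OF tN])
  interpret pair_sigma_finite \<mu> "\<kappa> t 1" ..
  note [measurable_cong] = sets_return[OF tN] \<mu>[unfolded represents_def, THEN conjunct1]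
  have "D (Suc j) x = (\<integral>\<^sup>+r. \<integral>\<^sup>+k. ennreal (max (k - x * r) 0) \<partial>\<mu> \<partial>\<kappa> t 1)"
    using \<mu> x t unfolding represents_def by simp
  also have "\<dots> = (\<integral>\<^sup>+k. \<integral>\<^sup>+r. ennreal (max (k - x * r) 0) \<partial>\<kappa> t 1 \<partial>\<mu>)"
    by (rule Fubini') measurable
  finally show ?thesis .
qed

text \<open>Since \<open>x * r\<close> is positive, each put is worth at most its strike, and the
  mean strike is the representation at \<open>y = 0\<close>, the value of the depleted fund
  \<open>- w\<close>.\<close>

lemma claim_value_Suc_finite:
  assumes \<mu>: "represents \<mu> j" and x: "x > 0"
  shows "D (Suc j) x < \<infinity>"
proof -
  let ?t = "N - Suc j"
  have tN: "?t < N" using N by simp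
  interpret \<nu>: prob_space "\<kappa> ?t 1" by (rule prob_return[OF tN])
  have "D (Suc j) x = (\<integral>\<^sup>+k. \<integral>\<^sup>+r. ennreal (max (k - x * r) 0) \<partial>\<kappa> ?t 1 \<partial>\<mu>)"
    using claim_value_Suc_eq_puts[OF \<mu> refl x] .
  also have "\<dots> \<le> (\<integral>\<^sup>+k. ennreal (max (k - 0) 0) \<partial>\<mu>)"
  proof (rule nn_integral_mono)
    fix k
    have "(\<integral>\<^sup>+r. ennreal (max (k - x * r) 0) \<partial>\<kappa> ?t 1) \<le> (\<integral>\<^sup>+r. ennreal (max (k - 0) 0) \<partial>\<kappa> ?t 1)"
    proof (rule nn_integral_mono_AE)
      show "AE r in \<kappa> ?t 1. ennreal (max (k - x * r) 0) \<le> ennreal (max (k - 0) 0)"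
        using return_pos[OF tN]
      proof eventually_elim
        fix r :: real assume "0 < r"
        then have "0 < x * r" using x by simp
        then show "ennreal (max (k - x * r) 0) \<le> ennreal (max (k - 0) 0)"
          by (intro ennreal_leI) auto
      qed
    qed
    then show "(\<integral>\<^sup>+r. ennreal (max (k - x * r) 0) \<partial>\<kappa> ?t 1) \<le> ennreal (max (k - 0) 0)"
      by (simp add: \<nu>.emeasure_space_1)
  qed
  also have "\<dots> = D j (0 - w)" using \<mu> unfolding represents_def by blast
  also have "\<dots> < \<infinity>" using w by (simp add: claim_value_depleted)
  finally show ?thesis .
qed

text \<open>The shift \<open>s = k - w\<close> accounts for the withdrawal and reduces the claim to
  \<open>nn_integral_gamma_call\<close> at \<open>y - w\<close>.\<close>

lemma nn_integral_gamma_put: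
  assumes "t < N" "K > 0"
  shows "(\<integral>\<^sup>+k. ennreal (K\<^sup>2 / (k - w) ^ 3 * f t (K / (k - w)) * max (k - y) 0) * indicator {w<..} k \<partial>lborel) =
         (\<integral>\<^sup>+r. ennreal (max (K - (y - w) * r) 0) \<partial>\<kappa> t 1)"
proof -
  note [measurable] = f_measurable[OF assms(1)]
  have "(\<integral>\<^sup>+k. ennreal (K\<^sup>2 / (k - w) ^ 3 * f t (K / (k - w)) * max (k - y) 0) * indicator {w<..} k \<partial>lborel) =
      (\<integral>\<^sup>+s. ennreal (K\<^sup>2 / s ^ 3 * f t (K / s) * max (s - (y - w)) 0) * indicator {0<..} s \<partial>lborel)"
    by (subst nn_integral_real_affine[where c=1 and t=w])
      (auto intro!: nn_integral_cong simp: indicator_def algebra_simps)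
  also have "\<dots> = (\<integral>\<^sup>+r. ennreal (max (K - (y - w) * r) 0) \<partial>\<kappa> t 1)"
    using assms f_nonneg f_eq_0 return_density prob_return return_mean
    by (intro nn_integral_gamma_call) auto
  finally show ?thesis .
qed

text \<open>Inductive step of the representation, with \<open>G\<close> as the next weight, possibly
  infinite at some points. Tonelli's theorem isolates each strike \<open>k'\<close>, for which the
  integral over \<open>k\<close> is a mean put payoff; averaging over \<mu> then has to give one
  more step of \<open>claim_value\<close>.\<close>

lemma nn_integral_gamma_transform:
  assumes \<mu>: "represents \<mu> j" and t: "t = N - Suc j"
  defines "G \<equiv> \<lambda>k. \<integral>\<^sup>+k'. ennreal (k'\<^sup>2 / (k - w) ^ 3 * f t (k' / (k - w))) \<partial>\<mu>"
  shows "G \<in> borel_measurable borel"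
    and "(\<integral>\<^sup>+k. G k * indicator {w<..} k * ennreal (max (k - y) 0) \<partial>lborel) = D (Suc j) (y - w)"
proof -
  have tN: "t < N" using N t by simp
  interpret \<mu>: finite_measure \<mu> using \<mu> by (rule represents_finite_measure)
  interpret \<nu>: prob_space "\<kappa> t 1" by (rule prob_return[OF tN])
  interpret pair_sigma_finite \<mu> "lborel :: real measure" ..
  note sets_\<mu>[measurable_cong] = \<mu>[unfolded represents_def, THEN conjunct1]
  note [measurable_cong] = sets_return[OF tN]
  note [measurable] = f_measurable[OF tN]
  show "G \<in> borel_measurable borel" unfolding G_def by measurable
  let ?H = "\<lambda>k' k. ennreal (k'\<^sup>2 / (k - w) ^ 3 * f t (k' / (k - w)) * max (k - y) 0) * indicator {w<..} k"
  \<comment> \<open>Strikes are at least \<open>w > 0\<close>, and the gamma formula holds for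
    positive strikes.\<close>
  have pos: "AE k' in \<mu>. 0 < k'"
    using \<mu> w unfolding represents_def by (auto elim!: eventually_mono)
  have "(\<integral>\<^sup>+k. G k * indicator {w<..} k * ennreal (max (k - y) 0) \<partial>lborel) = (\<integral>\<^sup>+k. \<integral>\<^sup>+k'. ?H k' k \<partial>\<mu> \<partial>lborel)"
  proof (rule nn_integral_cong)
    fix k :: real
    show "G k * indicator {w<..} k * ennreal (max (k - y) 0) = (\<integral>\<^sup>+k'. ?H k' k \<partial>\<mu>)"
      unfolding G_def ennreal_mult''[OF max.cobounded2]
      by (subst nn_integral_multc[symmetric], measurable, subst nn_integral_multc[symmetric], measurable,
          intro nn_integral_cong) (simp only: mult_ac)
  qed
  also have "\<dots> = (\<integral>\<^sup>+k'. \<integral>\<^sup>+k. ?H k' k \<partial>lborel \<partial>\<mu>)"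
    by (rule Fubini') measurable
  also have "\<dots> = (\<integral>\<^sup>+k'. \<integral>\<^sup>+r. ennreal (max (k' - (y - w) * r) 0) \<partial>\<kappa> t 1 \<partial>\<mu>)"
    by (intro nn_integral_cong_AE eventually_mono[OF pos] nn_integral_gamma_put[OF tN])
  also have "\<dots> = D (Suc j) (y - w)"
  proof (cases "y > w")
    case True
    then show ?thesis using claim_value_Suc_eq_puts[OF \<mu> t, of "y - w"] by simp
  next
    \<comment> \<open>The fund \<open>y - w\<close> is already depleted, so the payoff is in the
      money for every positive return and is affine in it; mean return 1 evaluates it.\<close>
    case False
    have "(\<integral>\<^sup>+r. ennreal (max (k' - (y - w) * r) 0) \<partial>\<kappa> t 1) = ennreal (max (k' - (y - w)) 0)"
      if k': "k' > 0" for k'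
    proof -
      have "(\<integral>\<^sup>+r. ennreal (max (k' - (y - w) * r) 0) \<partial>\<kappa> t 1) =
          (\<integral>\<^sup>+r. ennreal k' + ennreal (w - y) * ennreal r \<partial>\<kappa> t 1)"
      proof (rule nn_integral_cong_AE)
        show "AE r in \<kappa> t 1. ennreal (max (k' - (y - w) * r) 0) = ennreal k' + ennreal (w - y) * ennreal r"
          using return_pos[OF tN]
        proof eventually_elim
          fix r :: real assume r: "0 < r"
          have "0 \<le> (w - y) * r" using r False by simp
          then have "max (k' - (y - w) * r) 0 = k' + (w - y) * r" using k' by (simp add: algebra_simps)
          then show "ennreal (max (k' - (y - w) * r) 0) = ennreal k' + ennreal (w - y) * ennreal r"
            using k' r False by (simp add: ennreal_plus ennreal_mult)
        qed
      qed
      also have "\<dots> = ennreal k' + ennreal (w - y)"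
        by (simp add: nn_integral_add nn_integral_cmult return_mean[OF tN] \<nu>.emeasure_space_1)
      also have "\<dots> = ennreal (max (k' - (y - w)) 0)"
        using k' False by (simp flip: ennreal_plus)
      finally show ?thesis .
    qed
    then have "(\<integral>\<^sup>+k'. \<integral>\<^sup>+r. ennreal (max (k' - (y - w) * r) 0) \<partial>\<kappa> t 1 \<partial>\<mu>) =
        (\<integral>\<^sup>+k'. ennreal (max (k' - (y - w)) 0) \<partial>\<mu>)"
      using pos by (intro nn_integral_cong_AE) (auto elim!: eventually_mono)
    also have "\<dots> = D j (y - w - w)" using \<mu> unfolding represents_def by simp
    \<comment> \<open>Both funds are depleted, and the extra \<open>w\<close> subtracted from the
      fund on the left equals the extra remaining withdrawal on the right.\<close>
    also have "\<dots> = D (Suc j) (y - w)"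
      using False w by (simp add: claim_value_depleted algebra_simps)
    finally show ?thesis .
  qed
  finally show "(\<integral>\<^sup>+k. G k * indicator {w<..} k * ennreal (max (k - y) 0) \<partial>lborel) = D (Suc j) (y - w)" .
qed

text \<open>Passes from the extended weight to a real one. The form \<open>enn2real\<close> is the
  one in which the Bochner integral defining \<open>weight\<close> arrives, so infinite values
  become 0; they occur only on a null set.\<close>

lemma represents_gamma_transform:
  assumes \<mu>: "represents \<mu> j" and t: "t = N - Suc j"
    and g: "\<And>k. w < k \<Longrightarrow> g k = enn2real (\<integral>\<^sup>+k'. ennreal (k'\<^sup>2 / (k - w) ^ 3 * f t (k' / (k - w))) \<partial>\<mu>)"
  shows "(\<lambda>k. indicator {w<..} k * g k) \<in> borel_measurable borel"
    and "represents (density lborel (\<lambda>k. ennreal (indicator {w<..} k * g k))) (Suc j)"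
proof -
  define G where "G = (\<lambda>k. \<integral>\<^sup>+k'. ennreal (k'\<^sup>2 / (k - w) ^ 3 * f t (k' / (k - w))) \<partial>\<mu>)"
  have [measurable]: "G \<in> borel_measurable borel"
    unfolding G_def by (rule nn_integral_gamma_transform(1)[OF \<mu> t])
  have G: "(\<integral>\<^sup>+k. G k * indicator {w<..} k * ennreal (max (k - y) 0) \<partial>lborel) = D (Suc j) (y - w)" for y
    unfolding G_def by (rule nn_integral_gamma_transform(2)[OF \<mu> t])
  have g': "g k = enn2real (G k)" if "w < k" for k
    using g[OF that] by (simp add: G_def)
  then have gG: "indicator {w<..} k * g k = indicator {w<..} k * enn2real (G k)" for k
    by (auto simp: indicator_def)
  show meas[measurable]: "(\<lambda>k. indicator {w<..} k * g k) \<in> borel_measurable borel"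
    unfolding gG by measurable
  \<comment> \<open>For \<open>y = w - 1\<close> the payoff is positive on \<open>{w<..}\<close> and
    the total is the finite value of a fund at -1, so \<open>G\<close> is finite almost everywhere
    there.\<close>
  have "AE k in lborel. G k * indicator {w<..} k * ennreal (max (k - (w - 1)) 0) \<noteq> \<infinity>"
    by (rule nn_integral_PInf_AE, measurable) (simp only: G, simp add: claim_value_depleted)
  then have ae: "AE k in lborel. ennreal (indicator {w<..} k * g k) = G k * indicator {w<..} k"
    by eventually_elim (auto simp: g' indicator_def ennreal_mult_eq_top_iff less_top split: if_splits)
  show "represents (density lborel (\<lambda>k. ennreal (indicator {w<..} k * g k))) (Suc j)"
    unfolding represents_def
  proof (intro conjI allI)
    show "AE k in density lborel (\<lambda>k. ennreal (indicator {w<..} k * g k)). w \<le> k"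
      by (subst AE_density, measurable) (auto simp: indicator_def)
    fix y
    have "(\<integral>\<^sup>+k. ennreal (max (k - y) 0) \<partial>density lborel (\<lambda>k. ennreal (indicator {w<..} k * g k))) =
        (\<integral>\<^sup>+k. ennreal (indicator {w<..} k * g k) * ennreal (max (k - y) 0) \<partial>lborel)"
      by (rule nn_integral_density) measurable
    also have "\<dots> = (\<integral>\<^sup>+k. G k * indicator {w<..} k * ennreal (max (k - y) 0) \<partial>lborel)"
      using ae by (intro nn_integral_cong_AE) (auto elim!: eventually_mono)
    finally show "(\<integral>\<^sup>+k. ennreal (max (k - y) 0) \<partial>density lborel (\<lambda>k. ennreal (indicator {w<..} k * g k))) =
        D (Suc j) (y - w)"
      by (simp only: G)
  qed simp
qed

section \<open>Weight functions as densities of strikes\<close>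

definition weight_measure :: "nat \<Rightarrow> real measure" where
  "weight_measure t = density lborel (\<lambda>k. ennreal (indicator {w<..} k * weight \<kappa> N w t k))"

text \<open>Backward induction on \<open>t\<close>. The weight at \<open>t\<close> represents the
  value at time \<open>t + 1\<close>, hence the index \<open>N - Suc t\<close>. Measurability and
  nonnegativity are carried along because the integral defining the preceding weight is evaluated
  through them.\<close>

lemma represents_weight:
  assumes "Suc (Suc t) \<le> N"
  shows "(\<lambda>k. indicator {w<..} k * weight \<kappa> N w t k) \<in> borel_measurable borel"
    and "w < k \<Longrightarrow> 0 \<le> weight \<kappa> N w t k"
    and "represents (weight_measure t) (N - Suc t)"
proof -
  have "(\<lambda>k. indicator {w<..} k * weight \<kappa> N w t k) \<in> borel_measurable borel \<and>
      (\<forall>k>w. 0 \<le> weight \<kappa> N w t k) \<and> represents (weight_measure t) (N - Suc t)"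
    using assms
  proof (induction "N - Suc (Suc t)" arbitrary: t)
    case 0
    then have N2: "N = Suc (Suc t)" by simp
    \<comment> \<open>The first weight is a single gamma, that is, the gamma transform of the point
      mass at \<open>w\<close>.\<close>
    have eq: "weight \<kappa> N w t k = enn2real (\<integral>\<^sup>+k'. ennreal (k'\<^sup>2 / (k - w) ^ 3 * f (N - 1) (k' / (k - w))) \<partial>return borel w)"
      if "w < k" for k
      using that w f_nonneg[of "N - 1"] f_measurable[of "N - 1"] N
      by (subst weight.simps) (simp add: N2 gamma_eq nn_integral_return)
    have t': "N - 1 = N - Suc 0" by simp
    have nn: "\<forall>k>w. 0 \<le> weight \<kappa> N w t k" using eq by simp
    show ?case
      using represents_gamma_transform[where g="weight \<kappa> N w t", OF represents_return t' eq] nn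
      unfolding weight_measure_def by (simp add: N2)
  next
    case (Suc j)
    then have IH: "(\<lambda>k. indicator {w<..} k * weight \<kappa> N w (Suc t) k) \<in> borel_measurable borel"
        "\<And>k. w < k \<Longrightarrow> 0 \<le> weight \<kappa> N w (Suc t) k"
        "represents (weight_measure (Suc t)) (N - Suc (Suc t))"
      using Suc.hyps(1)[of "Suc t"] by auto
    note [measurable] = IH(1)
    have tN: "Suc t < N" using Suc by simp
    note [measurable] = f_measurable[OF tN]
    have eq: "weight \<kappa> N w t k = enn2real (\<integral>\<^sup>+k'. ennreal (k'\<^sup>2 / (k - w) ^ 3 * f (Suc t) (k' / (k - w))) \<partial>weight_measure (Suc t))"
      if k: "w < k" for k
    proof -
      have "weight \<kappa> N w t k = (LINT k':{w<..}|lborel. put_gamma \<kappa> (Suc t) k' (k - w) * weight \<kappa> N w (Suc t) k')"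
      proof -
        have "\<not> N \<le> t + 2" using Suc by simp
        then show ?thesis by (subst weight.simps) simp
      qed
      also have "\<dots> = (\<integral>k'. k'\<^sup>2 / (k - w) ^ 3 * f (Suc t) (k' / (k - w)) *
          (indicator {w<..} k' * weight \<kappa> N w (Suc t) k') \<partial>lborel)"
        unfolding set_lebesgue_integral_def
        using k w by (intro Bochner_Integration.integral_cong) (auto simp: indicator_def gamma_eq[OF tN])
      \<comment> \<open>Holds even if the integral diverges: a nonintegrable function has Bochner
        integral 0, and \<open>enn2real\<close> sends infinity to 0.\<close>
      also have "\<dots> = enn2real (\<integral>\<^sup>+k'. ennreal (k'\<^sup>2 / (k - w) ^ 3 * f (Suc t) (k' / (k - w)) *
          (indicator {w<..} k' * weight \<kappa> N w (Suc t) k')) \<partial>lborel)"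
        by (intro integral_eq_nn_integral, measurable)
          (use k IH(2) f_nonneg[OF tN] in \<open>auto simp: indicator_def\<close>)
      also have "\<dots> = enn2real (\<integral>\<^sup>+k'. ennreal (k'\<^sup>2 / (k - w) ^ 3 * f (Suc t) (k' / (k - w))) \<partial>weight_measure (Suc t))"
      proof -
        let ?W = "\<lambda>k'. indicator {w<..} k' * weight \<kappa> N w (Suc t) k'"
        let ?A = "\<lambda>k'. k'\<^sup>2 / (k - w) ^ 3 * f (Suc t) (k' / (k - w))"
        have W0: "0 \<le> ?W k'" for k' using IH(2) by (simp add: indicator_def)
        have "(\<integral>\<^sup>+k'. ennreal (?A k') \<partial>weight_measure (Suc t)) = (\<integral>\<^sup>+k'. ennreal (?W k') * ennreal (?A k') \<partial>lborel)"
          unfolding weight_measure_def by (rule nn_integral_density) measurable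
        then show ?thesis
          by (simp only: ennreal_mult'[OF W0, symmetric] mult.commute)
      qed
      finally show ?thesis .
    qed
    have t': "Suc t = N - Suc (N - Suc (Suc t))" using Suc by simp
    have j': "Suc (N - Suc (Suc t)) = N - Suc t" using Suc by simp
    show ?case
      using represents_gamma_transform[where g="weight \<kappa> N w t", OF IH(3) t' eq] eq
      unfolding weight_measure_def j' by simp
  qed
  then show "(\<lambda>k. indicator {w<..} k * weight \<kappa> N w t k) \<in> borel_measurable borel"
    "w < k \<Longrightarrow> 0 \<le> weight \<kappa> N w t k" "represents (weight_measure t) (N - Suc t)"
    by auto
qed

text \<open>\<open>claim_value_Suc_eq_puts\<close> for the weight measure gives the put mixture as
  an extended integral; finiteness of the claim value then yields integrability and the real
  identity.\<close>

lemma claim_value_eq_put_integral: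
  assumes t: "Suc (Suc t) \<le> N" and x: "x > 0"
  shows "set_integrable lborel {w<..} (\<lambda>k. weight \<kappa> N w t k * put_price \<kappa> t k x)"
    and "D (N - t) x < \<infinity>"
    and "enn2real (D (N - t) x) = (LINT k:{w<..}|lborel. weight \<kappa> N w t k * put_price \<kappa> t k x)"
proof -
  note W = represents_weight[OF t]
  have tN: "t < N" and j: "N - t = Suc (N - Suc t)" and t': "t = N - Suc (N - Suc t)" using t by auto
  interpret \<nu>: prob_space "\<kappa> t 1" by (rule prob_return[OF tN])
  note [measurable] = W(1)
  note [measurable_cong] = sets_return[OF tN]
  let ?p = "\<lambda>k. \<integral>\<^sup>+r. ennreal (max (k - x * r) 0) \<partial>\<kappa> t 1"
  let ?h = "\<lambda>k. indicator {w<..} k * (weight \<kappa> N w t k * put_price \<kappa> t k x)"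
  have put0: "put_price \<kappa> t k x \<ge> 0" for k unfolding put_price_def by simp
  have put_p: "ennreal (put_price \<kappa> t k x) = ?p k" "put_price \<kappa> t k x = enn2real (?p k)" if "w < k" for k
    using put0 put_eq[OF tN _ x, of k, symmetric] w that by simp_all
  \<comment> \<open>Writing the price as a parametrised integral over the return supplies its
    measurability in the strike.\<close>
  have h: "?h = (\<lambda>k. indicator {w<..} k * weight \<kappa> N w t k * enn2real (?p k))"
  proof (rule ext)
    fix k
    show "?h k = indicator {w<..} k * weight \<kappa> N w t k * enn2real (?p k)"
      using put_p(2)[of k] by (cases "w < k") simp_all
  qed
  have h_meas: "?h \<in> borel_measurable lborel" unfolding h by measurable
  have h0: "?h k \<ge> 0" for k using put0 W(2)[of k] by (auto simp: indicator_def)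
  show fin: "D (N - t) x < \<infinity>" unfolding j by (rule claim_value_Suc_finite[OF W(3) x])
  have "D (N - t) x = (\<integral>\<^sup>+k. ?p k \<partial>weight_measure t)"
    unfolding j by (rule claim_value_Suc_eq_puts[OF W(3) t' x])
  also have "\<dots> = (\<integral>\<^sup>+k. ennreal (indicator {w<..} k * weight \<kappa> N w t k) * ?p k \<partial>lborel)"
    unfolding weight_measure_def by (rule nn_integral_density) measurable
  also have "\<dots> = (\<integral>\<^sup>+k. ennreal (?h k) \<partial>lborel)"
  proof (intro nn_integral_cong)
    fix k
    show "ennreal (indicator {w<..} k * weight \<kappa> N w t k) * ?p k = ennreal (?h k)"
      using W(2)[of k] put0[of k] put_p(1)[of k]
      by (cases "w < k") (simp_all add: ennreal_mult)
  qed
  finally have eq: "D (N - t) x = (\<integral>\<^sup>+k. ennreal (?h k) \<partial>lborel)" .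
  show "set_integrable lborel {w<..} (\<lambda>k. weight \<kappa> N w t k * put_price \<kappa> t k x)"
    unfolding set_integrable_def using h_meas h0 fin eq by (intro integrableI_nonneg) auto
  show "enn2real (D (N - t) x) = (LINT k:{w<..}|lborel. weight \<kappa> N w t k * put_price \<kappa> t k x)"
    unfolding set_lebesgue_integral_def eq using h_meas h0
    by (subst integral_eq_nn_integral) auto
qed

end

section \<open>Transition laws and depletion\<close>

text \<open>Given \<open>G\<close>, the variable \<open>Y\<close> is distributed as \<open>Z\<close>
  times a return with law \<nu>. The conditional probabilities say so for fixed events; the
  extension covers integrands that also depend on \<omega> through \<open>G\<close>.\<close>

lemma (in prob_space) nn_integral_conditional_scaling:
  fixes Y Z :: "'a \<Rightarrow> real"
  assumes G: "subalgebra M G" and Z[measurable]: "Z \<in> borel_measurable G" and Y[measurable]: "Y \<in> borel_measurable M"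
    and \<nu>: "prob_space \<nu>" and sets_\<nu>[measurable_cong]: "sets \<nu> = sets borel"
    and cond: "\<And>A. A \<in> sets borel \<Longrightarrow>
      AE \<omega> in M. real_cond_exp M G (\<lambda>\<omega>. indicator A (Y \<omega>)) \<omega> = measure \<nu> {r. Z \<omega> * r \<in> A}"
    and \<phi>[measurable]: "\<phi> \<in> borel_measurable (G \<Otimes>\<^sub>M borel)"
  shows "(\<integral>\<^sup>+\<omega>. \<phi> (\<omega>, Y \<omega>) \<partial>M) = (\<integral>\<^sup>+\<omega>. \<integral>\<^sup>+r. \<phi> (\<omega>, Z \<omega> * r) \<partial>\<nu> \<partial>M)"
proof -
  interpret \<nu>: prob_space \<nu> by fact
  interpret G: finite_measure_subalgebra M G by unfold_locales (rule G)
  let ?MG = "restr_to_subalg M G"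
  have sets_MG[measurable_cong]: "sets ?MG = sets G" by (rule sets_restr_to_subalg[OF G])
  have space_G: "space G = space M" using G by (simp add: subalgebra_def)
  have id_meas[measurable]: "(\<lambda>\<omega>. \<omega>) \<in> measurable M G"
    by (rule measurable_from_subalg[OF G]) simp
  interpret MG: finite_measure ?MG
    by (rule finite_measure_restr_to_subalg[OF G]) unfold_locales
  let ?P1 = "distr M (G \<Otimes>\<^sub>M borel) (\<lambda>\<omega>. (\<omega>, Y \<omega>))"
  let ?P2 = "distr (?MG \<Otimes>\<^sub>M \<nu>) (G \<Otimes>\<^sub>M borel) (\<lambda>(\<omega>, r). (\<omega>, Z \<omega> * r))"
  \<comment> \<open>The two joint laws are compared on rectangles \<open>B \<times> A\<close>, where
    the defining property of conditional expectation on \<open>B\<close> applies; rectangles are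
    stable under intersection and generate.\<close>
  have P12: "?P1 = ?P2"
  proof (rule measure_eqI_generator_eq[where E="{a \<times> b | a b. a \<in> sets G \<and> b \<in> sets (borel :: real measure)}"
        and \<Omega>="space G \<times> space borel" and A="\<lambda>_. space G \<times> space borel"])
    show "Int_stable {a \<times> b | a b. a \<in> sets G \<and> b \<in> sets (borel :: real measure)}"
      by (rule Int_stable_pair_measure_generator)
    show "{a \<times> b | a b. a \<in> sets G \<and> b \<in> sets (borel :: real measure)} \<subseteq> Pow (space G \<times> space borel)"
      by (rule pair_measure_closed)
    show "sets ?P1 = sigma_sets (space G \<times> space borel) {a \<times> b | a b. a \<in> sets G \<and> b \<in> sets (borel :: real measure)}"
      "sets ?P2 = sigma_sets (space G \<times> space borel) {a \<times> b | a b. a \<in> sets G \<and> b \<in> sets (borel :: real measure)}"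
      by (simp_all add: sets_pair_measure)
    show "emeasure ?P1 (space G \<times> space borel) \<noteq> \<infinity>"
      by (subst emeasure_distr) auto
    fix X assume "X \<in> {a \<times> b | a b. a \<in> sets G \<and> b \<in> sets (borel :: real measure)}"
    then obtain B A where X: "X = B \<times> A" and B[measurable]: "B \<in> sets G" and A[measurable]: "A \<in> sets (borel :: real measure)"
      by auto
    have B'[measurable]: "B \<in> sets M" using G B by (auto simp: subalgebra_def)
    have intg: "integrable M (\<lambda>\<omega>. indicator B \<omega> * (indicator A (Y \<omega>) :: real))"
      by (rule integrable_const_bound[where B=1]) (auto simp: indicator_def)
    have "emeasure ?P1 X = (\<integral>\<^sup>+z. indicator X z \<partial>?P1)" using X by simp
    also have "\<dots> = (\<integral>\<^sup>+\<omega>. ennreal (indicator B \<omega> * indicator A (Y \<omega>)) \<partial>M)"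
      unfolding X by (subst nn_integral_distr) (auto intro!: nn_integral_cong simp: indicator_def)
    also have "\<dots> = ennreal (\<integral>\<omega>. indicator B \<omega> * indicator A (Y \<omega>) \<partial>M)"
      using intg by (rule nn_integral_eq_integral) simp
    also have "\<dots> = ennreal (\<integral>\<omega>. indicator B \<omega> * real_cond_exp M G (\<lambda>\<omega>. indicator A (Y \<omega>)) \<omega> \<partial>M)"
      by (subst G.real_cond_exp_intg(2)[OF intg]) auto
    also have "\<dots> = (\<integral>\<^sup>+\<omega>. ennreal (indicator B \<omega> * real_cond_exp M G (\<lambda>\<omega>. indicator A (Y \<omega>)) \<omega>) \<partial>M)"
      using cond[OF A]
      by (intro nn_integral_eq_integral[symmetric] G.real_cond_exp_intg(1)[OF intg])
        (auto elim!: eventually_mono)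
    also have "\<dots> = (\<integral>\<^sup>+\<omega>. indicator B \<omega> * emeasure \<nu> {r. Z \<omega> * r \<in> A} \<partial>M)"
      using cond[OF A]
      by (intro nn_integral_cong_AE) (auto elim!: eventually_mono simp: indicator_def \<nu>.emeasure_eq_measure)
    also have "\<dots> = (\<integral>\<^sup>+\<omega>. \<integral>\<^sup>+r. indicator X (\<omega>, Z \<omega> * r) \<partial>\<nu> \<partial>M)"
    proof (intro nn_integral_cong)
      fix \<omega>
      have "(\<integral>\<^sup>+r. indicator X (\<omega>, Z \<omega> * r) \<partial>\<nu>) = (\<integral>\<^sup>+r. indicator B \<omega> * indicator {r. Z \<omega> * r \<in> A} r \<partial>\<nu>)"
        by (intro nn_integral_cong) (auto simp: X indicator_def)
      also have "\<dots> = indicator B \<omega> * emeasure \<nu> {r. Z \<omega> * r \<in> A}"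
        by (subst nn_integral_cmult_indicator) auto
      finally show "indicator B \<omega> * emeasure \<nu> {r. Z \<omega> * r \<in> A} = (\<integral>\<^sup>+r. indicator X (\<omega>, Z \<omega> * r) \<partial>\<nu>)" ..
    qed
    also have "\<dots> = (\<integral>\<^sup>+\<omega>. \<integral>\<^sup>+r. indicator X (\<omega>, Z \<omega> * r) \<partial>\<nu> \<partial>?MG)"
      unfolding X by (intro nn_integral_subalgebra2[OF G, symmetric]) measurable
    also have "\<dots> = (\<integral>\<^sup>+p. indicator X (fst p, Z (fst p) * snd p) \<partial>(?MG \<Otimes>\<^sub>M \<nu>))"
      unfolding X by (subst \<nu>.nn_integral_fst[symmetric]) (simp_all, measurable)
    also have "\<dots> = (\<integral>\<^sup>+z. indicator X z \<partial>?P2)"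
      unfolding X by (subst nn_integral_distr) (auto intro!: nn_integral_cong simp: case_prod_unfold)
    also have "\<dots> = emeasure ?P2 X" using X by simp
    finally show "emeasure ?P1 X = emeasure ?P2 X" .
  qed (auto intro!: exI[of _ "space G"] exI[of _ "UNIV :: real set"])
  have "(\<integral>\<^sup>+\<omega>. \<phi> (\<omega>, Y \<omega>) \<partial>M) = (\<integral>\<^sup>+z. \<phi> z \<partial>?P1)"
    by (subst nn_integral_distr) auto
  also have "\<dots> = (\<integral>\<^sup>+p. \<phi> (fst p, Z (fst p) * snd p) \<partial>(?MG \<Otimes>\<^sub>M \<nu>))"
    unfolding P12 by (subst nn_integral_distr) (auto simp: case_prod_unfold)
  also have "\<dots> = (\<integral>\<^sup>+\<omega>. \<integral>\<^sup>+r. \<phi> (\<omega>, Z \<omega> * r) \<partial>\<nu> \<partial>?MG)"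
    by (subst \<nu>.nn_integral_fst[symmetric]) (simp_all, measurable)
  also have "\<dots> = (\<integral>\<^sup>+\<omega>. \<integral>\<^sup>+r. \<phi> (\<omega>, Z \<omega> * r) \<partial>\<nu> \<partial>M)"
    by (intro nn_integral_subalgebra2[OF G]) measurable
  finally show ?thesis .
qed

section \<open>Depletion events and claims in terms of fund values\<close>

lemma depletion_time_le_iff:
  "depletion_time N S w x0 \<omega> \<le> enat t \<longleftrightarrow> (\<exists>s\<le>t. s \<le> N \<and> fund S w x0 s \<omega> \<le> 0)"
proof
  let ?A = "{s. s \<le> N \<and> fund S w x0 s \<omega> \<le> 0}"
  assume le: "depletion_time N S w x0 \<omega> \<le> enat t"
  have "?A \<noteq> {}"
  proof
    assume "?A = {}"
    then have "depletion_time N S w x0 \<omega> = \<infinity>" unfolding depletion_time_def \<open>?A = {}\<close> by (simp add: top_enat_def)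
    with le show False by simp
  qed
  \<comment> \<open>The infimum of a nonempty set is attained because \<open>enat\<close> is
    well-ordered.\<close>
  then have "(INF s\<in>?A. enat s) \<in> enat ` ?A" by (metis (no_types, lifting) wellorder_InfI image_is_empty all_not_in_conv)
  then obtain s where "s \<in> ?A" "(INF s\<in>?A. enat s) = enat s" by auto
  then show "\<exists>s\<le>t. s \<le> N \<and> fund S w x0 s \<omega> \<le> 0" using le unfolding depletion_time_def by auto
next
  assume "\<exists>s\<le>t. s \<le> N \<and> fund S w x0 s \<omega> \<le> 0"
  then obtain s where s: "s \<le> t" "s \<le> N" "fund S w x0 s \<omega> \<le> 0" by auto
  then have "depletion_time N S w x0 \<omega> \<le> enat s" unfolding depletion_time_def by (intro INF_lower) auto
  also have "\<dots> \<le> enat t" using s by simp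
  finally show "depletion_time N S w x0 \<omega> \<le> enat t" .
qed

lemma depletion_time_eq_iff:
  assumes "t \<le> N"
  shows "depletion_time N S w x0 \<omega> = enat t \<longleftrightarrow>
    fund S w x0 t \<omega> \<le> 0 \<and> (\<forall>s<t. 0 < fund S w x0 s \<omega>)"
proof -
  let ?T = "depletion_time N S w x0 \<omega>"
  have T: "?T = enat t \<longleftrightarrow> ?T \<le> enat t \<and> (\<forall>s<t. \<not> ?T \<le> enat s)"
    by (cases ?T) (auto simp: not_le, metis le_neq_implies_less less_irrefl)
  have first: "(\<exists>s\<le>t. P s) \<and> (\<forall>s<t. \<not> (\<exists>r\<le>s. P r)) \<longleftrightarrow> P t \<and> (\<forall>s<t. \<not> P s)" for P :: "nat \<Rightarrow> bool"
    by (metis le_eq_less_or_eq le_less_trans)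
  show ?thesis
    unfolding T depletion_time_le_iff first using assms by (auto simp: not_le)
qed

lemma less_depletion_time_iff:
  "t \<le> N \<Longrightarrow> enat t < depletion_time N S w x0 \<omega> \<longleftrightarrow> (\<forall>s<Suc t. 0 < fund S w x0 s \<omega>)"
  using depletion_time_le_iff[of N S w x0 \<omega> t] by (auto simp: not_le[symmetric] less_Suc_eq_le)

lemma guarantee_claim_nonneg: "w \<ge> 0 \<Longrightarrow> 0 \<le> guarantee_claim N S w x0 t \<omega>"
  by (simp add: guarantee_claim_def)

lemma guarantee_claim_alive:
  assumes "t \<le> N" "\<forall>s<Suc t. 0 < fund S w x0 s \<omega>"
  shows "guarantee_claim N S w x0 t \<omega> = 0"
proof (cases t)
  case (Suc u)
  then have "\<not> depletion_time N S w x0 \<omega> \<le> enat (t - 1)" "depletion_time N S w x0 \<omega> \<noteq> enat t"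
    using assms by (auto simp: depletion_time_le_iff depletion_time_eq_iff not_le)
  then show ?thesis by (simp add: guarantee_claim_def)
qed (simp add: guarantee_claim_def)

text \<open>At depletion the shortfall is paid, and then \<open>w\<close> at each of the
  \<open>N - t\<close> later dates; this is the depleted branch of
  \<open>claim_value\<close>.\<close>

lemma sum_guarantee_claim_depleted:
  assumes t: "t \<le> N" "\<forall>s<t. 0 < fund S w x0 s \<omega>" "fund S w x0 t \<omega> \<le> 0" and "x0 > 0"
  shows "(\<Sum>u=t..N. guarantee_claim N S w x0 u \<omega>) = real (N - t) * w - fund S w x0 t \<omega>"
proof -
  \<comment> \<open>Time 0 must be excluded because the claim there is 0 by convention.\<close>
  have "t \<noteq> 0" using t(3) \<open>x0 > 0\<close> by (cases t) auto
  have T: "depletion_time N S w x0 \<omega> = enat t" using t by (simp add: depletion_time_eq_iff)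
  have now: "guarantee_claim N S w x0 t \<omega> = - fund S w x0 t \<omega>"
    using \<open>t \<noteq> 0\<close> t(3) by (cases t) (simp_all add: guarantee_claim_def T min_def)
  have "guarantee_claim N S w x0 u \<omega> = w" if "u \<in> {Suc t..N}" for u
    using that by (auto simp: guarantee_claim_def T)
  then have "(\<Sum>u=Suc t..N. guarantee_claim N S w x0 u \<omega>) = real (N - t) * w" by simp
  then show ?thesis using now t(1) by (simp add: sum.atLeast_Suc_atMost)
qed

text \<open>Substitute \<zeta> times the strike: one factor \<zeta> is the Jacobian and the other
  comes from the homogeneity of \<open>P\<close>.\<close>

lemma put_integral_rescale:
  fixes \<zeta> s x w :: real
  assumes "\<zeta> > 0" "w > 0" "x = \<zeta> * s"
    and hom: "\<And>k. k > 0 \<Longrightarrow> P (\<zeta> * k) x = \<zeta> * P k s"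
    and int: "set_integrable lborel {w<..} (\<lambda>k. g k * P k x)"
  shows "set_integrable lborel {w / \<zeta><..} (\<lambda>k. \<zeta>\<^sup>2 * g (\<zeta> * k) * P k s)"
    and "(LINT k:{w / \<zeta><..}|lborel. \<zeta>\<^sup>2 * g (\<zeta> * k) * P k s) = (LINT k:{w<..}|lborel. g k * P k x)"
proof -
  let ?h = "\<lambda>k. indicator {w<..} k *\<^sub>R (g k * P k x) :: real"
  have eq: "indicator {w / \<zeta><..} k *\<^sub>R (\<zeta>\<^sup>2 * g (\<zeta> * k) * P k s) = \<zeta> * ?h (0 + \<zeta> * k)" for k
  proof (cases "w / \<zeta> < k")
    case True
    then have "0 < k" using assms by (meson divide_pos_pos less_trans)
    moreover have "w < \<zeta> * k" using True assms by (simp add: field_simps)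
    ultimately show ?thesis using True hom[of k] by (simp add: power2_eq_square)
  next
    case False
    then have "\<not> w < \<zeta> * k" using assms by (simp add: field_simps)
    with False show ?thesis by simp
  qed
  have "integrable lborel ?h" using int by (simp add: set_integrable_def)
  then have "integrable lborel (\<lambda>k. ?h (0 + \<zeta> * k))"
    using \<open>\<zeta> > 0\<close> by (intro lborel_integrable_real_affine) auto
  then show "set_integrable lborel {w / \<zeta><..} (\<lambda>k. \<zeta>\<^sup>2 * g (\<zeta> * k) * P k s)"
    unfolding set_integrable_def eq by (rule integrable_mult_right)
  show "(LINT k:{w / \<zeta><..}|lborel. \<zeta>\<^sup>2 * g (\<zeta> * k) * P k s) = (LINT k:{w<..}|lborel. g k * P k x)"
    unfolding set_lebesgue_integral_def eq
    using lborel_integral_real_affine[of \<zeta> ?h 0] \<open>\<zeta> > 0\<close> by simp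
qed

section \<open>Guarantee value\<close>

text \<open>The Markov property appears in integrated form as \<open>transition\<close>: jointly
  with all information in \<open>F t\<close>, the next price is the current one times a return with
  law \<open>\<kappa> t 1\<close>.\<close>

locale withdrawal_guarantee = prob_space M + return_model N w \<kappa> f
  for M :: "'a measure" and N :: nat and w :: real and \<kappa> :: "nat \<Rightarrow> real \<Rightarrow> real measure"
    and f :: "nat \<Rightarrow> real \<Rightarrow> real" +
  fixes F :: "nat \<Rightarrow> 'a measure" and S :: "nat \<Rightarrow> 'a \<Rightarrow> real" and x0 :: real
  assumes x0: "x0 > 0"
    and filt: "filtration (space M) F" and subalg: "\<And>t. t \<le> N \<Longrightarrow> subalgebra M (F t)"
    and S_adapted: "\<And>t. t \<le> N \<Longrightarrow> S t \<in> borel_measurable (F t)"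
    and S_pos: "\<And>t. t \<le> N \<Longrightarrow> AE \<omega> in M. 0 < S t \<omega>"
    and transition: "\<And>t \<phi>. t < N \<Longrightarrow> \<phi> \<in> borel_measurable (F t \<Otimes>\<^sub>M borel) \<Longrightarrow>
        (\<integral>\<^sup>+\<omega>. \<phi> (\<omega>, S (Suc t) \<omega>) \<partial>M) = (\<integral>\<^sup>+\<omega>. \<integral>\<^sup>+r. \<phi> (\<omega>, S t \<omega> * r) \<partial>\<kappa> t 1 \<partial>M)"
begin

abbreviation X :: "nat \<Rightarrow> 'a \<Rightarrow> real" where "X \<equiv> fund S w x0"

abbreviation Z :: "nat \<Rightarrow> 'a \<Rightarrow> real" where
  "Z t \<omega> \<equiv> (\<Sum>u=t..N. guarantee_claim N S w x0 u \<omega>)"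

text \<open>Time \<open>t\<close> itself is left out, so that \<open>claim_value\<close> applies at
  \<open>t\<close> whether or not depletion occurs there. The event of depletion after
  \<open>t\<close> is \<open>alive (Suc t)\<close>.\<close>

definition alive :: "nat \<Rightarrow> 'a set" where
  "alive t = {\<omega> \<in> space M. \<forall>s<t. 0 < X s \<omega>}"

section \<open>Adaptedness and measurability\<close>

lemma F_space: "t \<le> N \<Longrightarrow> space (F t) = space M"
  using subalg by (simp add: subalgebra_def)

lemma F_mono: "s \<le> t \<Longrightarrow> sets (F s) \<subseteq> sets (F t)"
  using filt by (simp add: filtration_def)

lemma F_measurable_mono: "s \<le> t \<Longrightarrow> t \<le> N \<Longrightarrow> g \<in> measurable (F s) L \<Longrightarrow> g \<in> measurable (F t) L"
  using F_mono[of s t] F_space[of s] F_space[of t] by (auto simp: measurable_def)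

lemma F_M_measurable: "t \<le> N \<Longrightarrow> g \<in> measurable (F t) L \<Longrightarrow> g \<in> measurable M L"
  using measurable_from_subalg[OF subalg] .

lemma fund_adapted: "s \<le> t \<Longrightarrow> t \<le> N \<Longrightarrow> X s \<in> borel_measurable (F t)"
proof (induction s)
  case (Suc s)
  then have [measurable]: "X s \<in> borel_measurable (F t)" by simp
  have [measurable]: "S s \<in> borel_measurable (F t)" "S (Suc s) \<in> borel_measurable (F t)"
    using Suc F_measurable_mono[OF _ _ S_adapted, of _ t] by auto
  have "X (Suc s) = (\<lambda>\<omega>. X s \<omega> * (S (Suc s) \<omega> / S s \<omega>) - w)" by (simp add: fun_eq_iff)
  then show ?case by simp
next
  case 0
  have "X 0 = (\<lambda>_. x0)" by (simp add: fun_eq_iff)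
  then show ?case by simp
qed

lemma alive_adapted: "t \<le> Suc u \<Longrightarrow> u \<le> N \<Longrightarrow> alive t \<in> sets (F u)"
proof -
  assume t: "t \<le> Suc u" "u \<le> N"
  have "alive t = {\<omega> \<in> space (F u). \<forall>s\<in>{..<t}. 0 < X s \<omega>}"
    using F_space t by (auto simp: alive_def)
  also have "\<dots> \<in> sets (F u)"
  proof (intro sets.sets_Collect_finite_All)
    fix s assume "s \<in> {..<t}"
    then have [measurable]: "X s \<in> borel_measurable (F u)" using t by (intro fund_adapted) auto
    show "{\<omega> \<in> space (F u). 0 < X s \<omega>} \<in> sets (F u)" by measurable
  qed simp
  finally show ?thesis .
qed

lemma claim_measurable[measurable]: "u \<le> N \<Longrightarrow> guarantee_claim N S w x0 u \<in> borel_measurable M"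
proof -
  assume u: "u \<le> N"
  have X[measurable]: "X s \<in> borel_measurable M" if "s \<le> N" for s
    using fund_adapted[OF order_refl that] F_M_measurable that by blast
  have m1[measurable]: "Measurable.pred M (\<lambda>\<omega>. \<exists>s\<in>{..u-1}. X s \<omega> \<le> 0)"
    by (rule pred_intros_finite) (use X u in \<open>auto intro!: borel_measurable_pred_less simp: pred_def\<close>)
  have m2[measurable]: "Measurable.pred M (\<lambda>\<omega>. \<forall>s\<in>{..<u}. 0 < X s \<omega>)"
    by (rule pred_intros_finite) (use X u in \<open>auto intro!: borel_measurable_pred_less simp: pred_def\<close>)
  have m3[measurable]: "X u \<in> borel_measurable M" using X u by simp
  \<comment> \<open>Finitely many fund values decide the depletion events, which makes measurability
    evident.\<close>
  have eq: "guarantee_claim N S w x0 u = (\<lambda>\<omega>. if u = 0 then 0 else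
      w * of_bool (\<exists>s\<in>{..u-1}. X s \<omega> \<le> 0) +
      (- min 0 (X u \<omega>)) * of_bool (X u \<omega> \<le> 0 \<and> (\<forall>s\<in>{..<u}. 0 < X s \<omega>)))"
  proof (rule ext)
    fix \<omega>
    have "depletion_time N S w x0 \<omega> \<le> enat (u - 1) \<longleftrightarrow> (\<exists>s\<in>{..u-1}. X s \<omega> \<le> 0)"
      using u by (auto simp: depletion_time_le_iff)
    moreover have "depletion_time N S w x0 \<omega> = enat u \<longleftrightarrow> X u \<omega> \<le> 0 \<and> (\<forall>s\<in>{..<u}. 0 < X s \<omega>)"
      using u by (auto simp: depletion_time_eq_iff)
    ultimately show "guarantee_claim N S w x0 u \<omega> = (if u = 0 then 0 else
      w * of_bool (\<exists>s\<in>{..u-1}. X s \<omega> \<le> 0) +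
      (- min 0 (X u \<omega>)) * of_bool (X u \<omega> \<le> 0 \<and> (\<forall>s\<in>{..<u}. 0 < X s \<omega>)))"
      by (simp only: guarantee_claim_def)
  qed
  show "guarantee_claim N S w x0 u \<in> borel_measurable M"
    unfolding eq by measurable
qed

lemma Z_measurable[measurable]: "Z t \<in> borel_measurable M"
  by (intro borel_measurable_sum) auto

lemma Z_nonneg: "0 \<le> Z t \<omega>"
  using w by (intro sum_nonneg guarantee_claim_nonneg) auto

text \<open>Identifies \<open>D\<close> as the conditional value of the remaining claims, tested on
  events \<open>B\<close> known at \<open>t\<close>, by backward induction from
  \<open>N\<close>.\<close>

lemma nn_integral_future_claims:
  assumes "t \<le> N" "B \<in> sets (F t)"
  shows "(\<integral>\<^sup>+\<omega>. indicator (B \<inter> alive t) \<omega> * ennreal (Z t \<omega>) \<partial>M) =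
         (\<integral>\<^sup>+\<omega>. indicator (B \<inter> alive t) \<omega> * D (N - t) (X t \<omega>) \<partial>M)"
  using assms
proof (induction t arbitrary: B rule: inc_induct)
  case base
  have "ennreal (Z N \<omega>) = D 0 (X N \<omega>)" if "\<omega> \<in> alive N" for \<omega>
  proof (cases "X N \<omega> \<le> 0")
    case True
    then show ?thesis using sum_guarantee_claim_depleted[of N N S w x0 \<omega>] that x0 by (simp add: alive_def)
  next
    case False
    then have "\<forall>s<Suc N. 0 < X s \<omega>" using that by (auto simp: alive_def less_Suc_eq)
    then show ?thesis using False guarantee_claim_alive[of N N S w x0 \<omega>] by (simp add: ennreal_neg)
  qed
  then show ?case by (intro nn_integral_cong) (auto simp: indicator_def)
next
  case (step t)
  have tN: "t < N" "Suc t \<le> N" "t \<le> N" using step by auto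
  have D_Suc: "N - t = Suc (N - Suc t)" "N - Suc (N - Suc t) = t" using tN by auto
  note S_t[measurable] = S_adapted[OF tN(3)]
  note X_t[measurable] = fund_adapted[OF order_refl tN(3)]
  have [measurable]: "B \<in> sets (F t)" "alive t \<in> sets (F t)" "alive (Suc t) \<in> sets (F t)"
    using step tN alive_adapted by auto
  have B': "B \<in> sets (F (Suc t))" using step.prems F_mono[of t "Suc t"] by auto
  interpret \<nu>: prob_space "\<kappa> t 1" by (rule prob_return[OF tN(1)])
  note [measurable_cong] = sets_return[OF tN(1)]
  let ?R = "\<lambda>\<omega>. indicator (B \<inter> alive t \<inter> {\<omega>\<in>space (F t). X t \<omega> \<le> 0}) \<omega> * ennreal (real (N - t) * w - X t \<omega>)"
  have alive_Suc: "alive (Suc t) = alive t \<inter> {\<omega>. 0 < X t \<omega>}"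
    by (auto simp: alive_def less_Suc_eq)
  have R_meas: "?R \<in> borel_measurable M"
    by (rule F_M_measurable[OF tN(3)]) measurable
  have BA: "B \<inter> alive (Suc t) \<in> sets M"
    using subalg[OF tN(3)] by (auto simp: subalgebra_def)
  \<comment> \<open>Either depletion happens at \<open>t\<close>, and the remaining claims are known
    exactly, or the fund survives, nothing is paid at \<open>t\<close> and the induction hypothesis
    takes over.\<close>
  have split1: "indicator (B \<inter> alive t) \<omega> * ennreal (Z t \<omega>) =
      ?R \<omega> + indicator (B \<inter> alive (Suc t)) \<omega> * ennreal (Z (Suc t) \<omega>)" for \<omega>
  proof (cases "\<omega> \<in> B \<inter> alive t")
    case True
    then have al: "\<forall>s<t. 0 < X s \<omega>" "\<omega> \<in> space (F t)" using F_space[OF tN(3)] by (auto simp: alive_def)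
    show ?thesis
    proof (cases "X t \<omega> \<le> 0")
      case True
      then show ?thesis
        using \<open>\<omega> \<in> B \<inter> alive t\<close> al sum_guarantee_claim_depleted[OF tN(3) al(1) True x0]
        by (simp add: alive_Suc)
    next
      case False
      then have "\<forall>s<Suc t. 0 < X s \<omega>" using al by (auto simp: less_Suc_eq)
      then have "guarantee_claim N S w x0 t \<omega> = 0" by (rule guarantee_claim_alive[OF tN(3)])
      then have "Z t \<omega> = Z (Suc t) \<omega>" using tN by (simp add: sum.atLeast_Suc_atMost)
      then show ?thesis using \<open>\<omega> \<in> B \<inter> alive t\<close> False by (simp add: alive_Suc)
    qed
  qed (auto simp: alive_Suc)
  have split2: "indicator (B \<inter> alive t) \<omega> * D (N - t) (X t \<omega>) =
      ?R \<omega> + indicator (B \<inter> alive (Suc t)) \<omega> * (\<integral>\<^sup>+r. D (N - Suc t) (X t \<omega> * r - w) \<partial>\<kappa> t 1)" for \<omega>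
  proof (cases "\<omega> \<in> B \<inter> alive t")
    case True
    then have "\<omega> \<in> space (F t)" using F_space[OF tN(3)] by (auto simp: alive_def)
    then show ?thesis using True D_Suc by (cases "X t \<omega> \<le> 0") (simp_all add: alive_Suc)
  qed (auto simp: alive_Suc)
  \<comment> \<open>The next fund value is expressed by quantities known at \<open>t\<close> and the
    next price \<open>y\<close>, the shape that \<open>transition\<close> requires.\<close>
  let ?\<phi> = "\<lambda>(\<omega>, y). indicator (B \<inter> alive (Suc t)) \<omega> * D (N - Suc t) (X t \<omega> * (y / S t \<omega>) - w)"
  have \<phi>: "?\<phi> \<in> borel_measurable (F t \<Otimes>\<^sub>M borel)" by measurable
  have "(\<integral>\<^sup>+\<omega>. indicator (B \<inter> alive (Suc t)) \<omega> * ennreal (Z (Suc t) \<omega>) \<partial>M) =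
      (\<integral>\<^sup>+\<omega>. indicator (B \<inter> alive (Suc t)) \<omega> * D (N - Suc t) (X (Suc t) \<omega>) \<partial>M)"
    using step.IH[OF B'] .
  also have "\<dots> = (\<integral>\<^sup>+\<omega>. ?\<phi> (\<omega>, S (Suc t) \<omega>) \<partial>M)" by simp
  also have "\<dots> = (\<integral>\<^sup>+\<omega>. \<integral>\<^sup>+r. ?\<phi> (\<omega>, S t \<omega> * r) \<partial>\<kappa> t 1 \<partial>M)"
    by (rule transition[OF tN(1) \<phi>])
  also have "\<dots> = (\<integral>\<^sup>+\<omega>. indicator (B \<inter> alive (Suc t)) \<omega> *
      (\<integral>\<^sup>+r. D (N - Suc t) (X t \<omega> * r - w) \<partial>\<kappa> t 1) \<partial>M)"
    \<comment> \<open>Positivity of the price lets \<open>S t \<omega>\<close> cancel, leaving the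
      pure return.\<close>
    using S_pos[OF tN(3)]
    by (intro nn_integral_cong_AE) (auto elim!: eventually_mono simp: nn_integral_cmult)
  finally have main: "(\<integral>\<^sup>+\<omega>. indicator (B \<inter> alive (Suc t)) \<omega> * ennreal (Z (Suc t) \<omega>) \<partial>M) =
      (\<integral>\<^sup>+\<omega>. indicator (B \<inter> alive (Suc t)) \<omega> * (\<integral>\<^sup>+r. D (N - Suc t) (X t \<omega> * r - w) \<partial>\<kappa> t 1) \<partial>M)" .
  have m1: "(\<lambda>\<omega>. indicator (B \<inter> alive (Suc t)) \<omega> * ennreal (Z (Suc t) \<omega>)) \<in> borel_measurable M"
    using BA by measurable
  have m2: "(\<lambda>\<omega>. indicator (B \<inter> alive (Suc t)) \<omega> * (\<integral>\<^sup>+r. D (N - Suc t) (X t \<omega> * r - w) \<partial>\<kappa> t 1)) \<in> borel_measurable M"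
    by (rule F_M_measurable[OF tN(3)]) measurable
  show ?case
    unfolding split1 split2 nn_integral_add[OF R_meas m1] nn_integral_add[OF R_meas m2] main ..
qed

text \<open>At time 0 the event \<open>alive 0\<close> is the whole space, so the expected total
  claim is \<open>D N x0\<close>, which is finite. Later sums are dominated because claims are
  nonnegative.\<close>

lemma integrable_Z:
  assumes "N \<ge> 2" shows "integrable M (Z t)"
proof -
  have "integrable M (Z 0)"
  proof (rule integrableI_nonneg)
    have "(\<integral>\<^sup>+\<omega>. ennreal (Z 0 \<omega>) \<partial>M) = (\<integral>\<^sup>+\<omega>. indicator (space (F 0) \<inter> alive 0) \<omega> * ennreal (Z 0 \<omega>) \<partial>M)"
      by (intro nn_integral_cong) (simp add: alive_def F_space)
    also have "\<dots> = (\<integral>\<^sup>+\<omega>. indicator (space (F 0) \<inter> alive 0) \<omega> * D (N - 0) (X 0 \<omega>) \<partial>M)"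
      by (rule nn_integral_future_claims) auto
    also have "\<dots> = (\<integral>\<^sup>+\<omega>. D N x0 \<partial>M)"
      by (intro nn_integral_cong) (simp add: alive_def F_space)
    also have "\<dots> = D N x0" by (simp add: emeasure_space_1)
    also have "\<dots> < \<infinity>" using claim_value_eq_put_integral(2)[of 0 x0] assms x0 by simp
    finally show "(\<integral>\<^sup>+\<omega>. ennreal (Z 0 \<omega>) \<partial>M) < \<infinity>" .
  qed (use Z_nonneg in auto)
  then show ?thesis
  proof (rule Bochner_Integration.integrable_bound)
    show "AE \<omega> in M. norm (Z t \<omega>) \<le> norm (Z 0 \<omega>)"
    proof (rule AE_I2)
      fix \<omega>
      have "Z t \<omega> \<le> Z 0 \<omega>"
        using w by (intro sum_mono2 guarantee_claim_nonneg) auto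
      then show "norm (Z t \<omega>) \<le> norm (Z 0 \<omega>)" by (simp add: Z_nonneg)
    qed
  qed simp
qed

text \<open>On the survival event, known at \<open>t\<close>, the claim value has the same integrals
  over \<open>F t\<close> events as the remaining claims; the indicator of that event is then pulled
  out of the conditional expectation.\<close>

lemma guarantee_value_eq_claim_value:
  assumes t: "Suc (Suc t) \<le> N"
  shows "AE \<omega> in M. depletion_time N S w x0 \<omega> > enat t \<longrightarrow>
     guarantee_value N M F S w x0 t \<omega> = enn2real (D (N - t) (X t \<omega>))"
proof -
  have tN: "t \<le> N" using t by simp
  interpret Ft: finite_measure_subalgebra M "F t" by unfold_locales (rule subalg[OF tN])
  let ?E = "alive (Suc t)"
  have E[measurable]: "?E \<in> sets (F t)" by (rule alive_adapted) (use tN in auto)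
  have sub: "A \<in> sets (F t) \<Longrightarrow> A \<in> sets M" for A using subalg[OF tN] by (auto simp: subalgebra_def)
  note E_M[measurable] = sub[OF E]
  have X_t[measurable]: "X t \<in> borel_measurable (F t)" by (rule fund_adapted[OF order_refl tN])
  define g where "g \<omega> = indicator ?E \<omega> * enn2real (D (N - t) (X t \<omega>))" for \<omega>
  have g_meas[measurable]: "g \<in> borel_measurable (F t)" unfolding g_def by measurable
  have g_M[measurable]: "g \<in> borel_measurable M" by (rule F_M_measurable[OF tN g_meas])
  have g0: "0 \<le> g \<omega>" for \<omega> by (simp add: g_def)
  \<comment> \<open>On \<open>?E\<close> the fund is positive and the claim value finite, so
    \<open>enn2real\<close> loses nothing.\<close>
  have g_enn: "ennreal (g \<omega>) = indicator ?E \<omega> * D (N - t) (X t \<omega>)" for \<omega>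
    using claim_value_eq_put_integral(2)[OF t, of "X t \<omega>"] by (auto simp: g_def indicator_def alive_def)
  have EZ: "integrable M (\<lambda>\<omega>. indicator ?E \<omega> * Z t \<omega>)"
    using integrable_mult_indicator[OF E_M integrable_Z[of t]] t by simp
  have nn: "(\<integral>\<^sup>+\<omega>. ennreal (indicator B \<omega> * (indicator ?E \<omega> * Z t \<omega>)) \<partial>M) =
      (\<integral>\<^sup>+\<omega>. ennreal (indicator B \<omega> * g \<omega>) \<partial>M)" if B: "B \<in> sets (F t)" for B
  proof -
    have BE: "B \<inter> ?E \<in> sets (F t)" using B E by auto
    have i: "indicator (B \<inter> ?E \<inter> alive t) \<omega> = (indicator (B \<inter> ?E) \<omega> :: ennreal)" for \<omega>
      by (auto simp: indicator_def alive_def)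
    have "(\<integral>\<^sup>+\<omega>. ennreal (indicator B \<omega> * (indicator ?E \<omega> * Z t \<omega>)) \<partial>M) =
        (\<integral>\<^sup>+\<omega>. indicator (B \<inter> ?E) \<omega> * ennreal (Z t \<omega>) \<partial>M)"
      by (intro nn_integral_cong) (auto simp: indicator_def)
    also have "\<dots> = (\<integral>\<^sup>+\<omega>. indicator (B \<inter> ?E) \<omega> * D (N - t) (X t \<omega>) \<partial>M)"
      using nn_integral_future_claims[OF tN BE] by (simp only: i)
    also have "\<dots> = (\<integral>\<^sup>+\<omega>. ennreal (indicator B \<omega> * g \<omega>) \<partial>M)"
    proof (intro nn_integral_cong)
      fix \<omega>
      show "indicator (B \<inter> ?E) \<omega> * D (N - t) (X t \<omega>) = ennreal (indicator B \<omega> * g \<omega>)"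
        using g_enn[of \<omega>] by (cases "\<omega> \<in> B"; cases "\<omega> \<in> ?E") simp_all
    qed
    finally show ?thesis .
  qed
  have g_int: "integrable M g"
  proof (rule integrableI_nonneg)
    have "(\<integral>\<^sup>+\<omega>. ennreal (g \<omega>) \<partial>M) = (\<integral>\<^sup>+\<omega>. ennreal (indicator (space (F t)) \<omega> * g \<omega>) \<partial>M)"
      by (intro nn_integral_cong) (simp add: F_space[OF tN])
    also have "\<dots> = (\<integral>\<^sup>+\<omega>. ennreal (indicator (space (F t)) \<omega> * (indicator ?E \<omega> * Z t \<omega>)) \<partial>M)"
      by (rule nn[symmetric]) auto
    also have "\<dots> = (\<integral>\<^sup>+\<omega>. ennreal (indicator ?E \<omega> * Z t \<omega>) \<partial>M)"
      by (intro nn_integral_cong) (simp add: F_space[OF tN])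
    also have "\<dots> < \<infinity>"
      using EZ Z_nonneg by (subst nn_integral_eq_integral) auto
    finally show "(\<integral>\<^sup>+\<omega>. ennreal (g \<omega>) \<partial>M) < \<infinity>" .
  qed (use g0 in auto)
  have "AE \<omega> in M. real_cond_exp M (F t) (\<lambda>\<omega>. indicator ?E \<omega> * Z t \<omega>) \<omega> = g \<omega>"
  proof (rule Ft.real_cond_exp_charact[OF _ EZ g_int g_meas])
    fix B assume B: "B \<in> sets (F t)"
    note [measurable] = sub[OF B]
    show "set_lebesgue_integral M B (\<lambda>\<omega>. indicator ?E \<omega> * Z t \<omega>) = set_lebesgue_integral M B g"
      unfolding set_lebesgue_integral_def real_scaleR_def
      using nn[OF B] g0 Z_nonneg by (subst (1 2) integral_eq_nn_integral) auto
  qed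
  moreover have "AE \<omega> in M. real_cond_exp M (F t) (\<lambda>\<omega>. indicator ?E \<omega> * Z t \<omega>) \<omega> =
      indicator ?E \<omega> * real_cond_exp M (F t) (Z t) \<omega>"
    by (rule Ft.real_cond_exp_mult[OF _ _ EZ]) measurable
  ultimately show ?thesis
    using AE_space
  proof eventually_elim
    case (elim \<omega>)
    show ?case
    proof
      assume "enat t < depletion_time N S w x0 \<omega>"
      then have "\<omega> \<in> ?E" using elim(3) tN by (simp add: less_depletion_time_iff alive_def)
      then show "guarantee_value N M F S w x0 t \<omega> = enn2real (D (N - t) (X t \<omega>))"
        using elim(1,2) by (simp add: guarantee_value_def g_def)
    qed
  qed
qed

end

text \<open>The hypotheses are reduced to return densities of mean 1 and the integrated transition
  law. The value is then the claim value, a put mixture in the fund, and rescaling by the fund units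
  turns it into puts on the asset.\<close>

theorem mainTheorem2:
  fixes M :: "'a measure" and F :: "nat \<Rightarrow> 'a measure" and S :: "nat \<Rightarrow> 'a \<Rightarrow> real"
    and \<kappa> :: "nat \<Rightarrow> real \<Rightarrow> real measure" and N :: nat and w x0 :: real
  assumes "N \<ge> 2" and "w > 0" and "x0 > 0"
    and "prob_space M"
    and "filtration (space M) F" and "\<forall>t\<le>N. subalgebra M (F t)"
    and "martingale_upto N M F S"
    and "\<forall>t\<le>N. AE \<omega> in M. 0 < S t \<omega>"
    and "AE \<omega> in M. S 0 \<omega> = 1"
    and "regular_markov N M F S \<kappa>"
    and "independent_returns N \<kappa>"
  shows
    "(\<forall>t\<le>N - 2. AE \<omega> in M. depletion_time N S w x0 \<omega> > enat t \<longrightarrow>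
        (let X = fund S w x0 t \<omega>; \<zeta> = fund_units S w x0 t \<omega> in
          set_integrable lborel {w / \<zeta><..}
            (\<lambda>k'. \<zeta>\<^sup>2 * weight \<kappa> N w t (\<zeta> * k') * put_price \<kappa> t k' (S t \<omega>)) \<and>
          guarantee_value N M F S w x0 t \<omega> =
            (LINT k':{w / \<zeta><..}|lborel. \<zeta>\<^sup>2 * weight \<kappa> N w t (\<zeta> * k') * put_price \<kappa> t k' (S t \<omega>)) \<and>
          set_integrable lborel {w<..} (\<lambda>k. weight \<kappa> N w t k * put_price \<kappa> t k X) \<and>
          guarantee_value N M F S w x0 t \<omega> =
            (LINT k:{w<..}|lborel. weight \<kappa> N w t k * put_price \<kappa> t k X))) \<and>
     (AE \<omega> in M. guarantee_value N M F S w x0 0 \<omega> =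
        (LINT k:{w<..}|lborel. weight \<kappa> N w 0 k * put_price \<kappa> 0 k x0))"
proof -
  interpret prob_space M by fact
  note rm = \<open>regular_markov N M F S \<kappa>\<close> and ir = \<open>independent_returns N \<kappa>\<close>
  have mk: "markov_with_kernels N M F S \<kappa>" using rm by (simp add: regular_markov_def)
  have sub: "subalgebra M (F t)" if "t \<le> N" for t using assms(6) that by blast
  have S_F: "S t \<in> borel_measurable (F t)" if "t \<le> N" for t
    using mk that by (simp add: markov_with_kernels_def)
  have S_M[measurable]: "S t \<in> borel_measurable M" if "t \<le> N" for t
    by (rule measurable_from_subalg[OF sub S_F]) (use that in auto)
  have S_pos: "AE \<omega> in M. 0 < S t \<omega>" if "t \<le> N" for t using assms(8) that by blast
  note k1 = markov_kernel[OF mk _ zero_less_one]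
  have transition: "(\<integral>\<^sup>+\<omega>. \<phi> (\<omega>, S (Suc t) \<omega>) \<partial>M) = (\<integral>\<^sup>+\<omega>. \<integral>\<^sup>+r. \<phi> (\<omega>, S t \<omega> * r) \<partial>\<kappa> t 1 \<partial>M)"
    if t: "t < N" and \<phi>: "\<phi> \<in> borel_measurable (F t \<Otimes>\<^sub>M borel)" for t \<phi>
  proof (rule nn_integral_conditional_scaling[OF sub S_F _ k1(1,2)[OF t] _ \<phi>])
    note [measurable_cong] = k1(2)[OF t]
    fix A :: "real set" assume A[measurable]: "A \<in> sets borel"
    have "AE \<omega> in M. real_cond_exp M (F t) (\<lambda>\<omega>. indicator A (S (t + 1) \<omega>)) \<omega> = measure (\<kappa> t (S t \<omega>)) A"
      using mk t A unfolding markov_with_kernels_def by blast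
    moreover have "AE \<omega> in M. 0 < S t \<omega>" using S_pos t by simp
    ultimately show "AE \<omega> in M. real_cond_exp M (F t) (\<lambda>\<omega>. indicator A (S (Suc t) \<omega>)) \<omega> =
        measure (\<kappa> t 1) {r. S t \<omega> * r \<in> A}"
    proof eventually_elim
      case (elim \<omega>)
      have "measure (\<kappa> t (S t \<omega>)) A = measure (distr (\<kappa> t 1) borel (\<lambda>r. S t \<omega> * r)) A"
        using independent_returns_kernel[OF mk ir t elim(2)] by simp
      also have "\<dots> = measure (\<kappa> t 1) {r. S t \<omega> * r \<in> A}"
        using sets_eq_imp_space_eq[OF k1(2)[OF t]] by (subst measure_distr) (auto simp: vimage_def)
      finally show ?case using elim by simp
    qed
  qed (use t in auto)
  \<comment> \<open>Conditioning on \<open>F 0\<close> reduces the mean to the initial price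
    1.\<close>
  have S_mean: "(\<integral>\<^sup>+\<omega>. ennreal (S t \<omega>) \<partial>M) = 1" if t: "t \<le> N" for t
  proof -
    interpret F0: finite_measure_subalgebra M "F 0" by unfold_locales (rule sub, simp)
    have int: "integrable M (S t)" and mart: "AE \<omega> in M. real_cond_exp M (F 0) (S t) \<omega> = S 0 \<omega>"
      using assms(7) t unfolding martingale_upto_def by auto
    have "(\<integral>\<omega>. S t \<omega> \<partial>M) = (\<integral>\<omega>. real_cond_exp M (F 0) (S t) \<omega> \<partial>M)"
      by (rule F0.real_cond_exp_int(2)[OF int, symmetric])
    also have "\<dots> = (\<integral>\<omega>. 1 \<partial>M)"
      using mart assms(9) S_M[of 0] by (intro integral_cong_AE) (auto elim: eventually_elim2)
    also have "\<dots> = 1" by (simp add: prob_space)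
    finally have "(\<integral>\<omega>. S t \<omega> \<partial>M) = 1" .
    moreover have "(\<integral>\<^sup>+\<omega>. ennreal (S t \<omega>) \<partial>M) = ennreal (\<integral>\<omega>. S t \<omega> \<partial>M)"
      using int S_pos[OF t] by (intro nn_integral_eq_integral) (auto elim: eventually_mono)
    ultimately show ?thesis by simp
  qed
  have mean: "(\<integral>\<^sup>+r. ennreal r \<partial>\<kappa> t 1) = 1" if t: "t < N" for t
  proof -
    note [measurable_cong] = k1(2)[OF t]
    \<comment> \<open>The transition law for the second projection factors the mean of the next
      price into the mean current price and the mean return.\<close>
    have "1 = (\<integral>\<^sup>+\<omega>. ennreal (snd (\<omega>, S (Suc t) \<omega>)) \<partial>M)" using S_mean[of "Suc t"] t by simp
    also have "\<dots> = (\<integral>\<^sup>+\<omega>. \<integral>\<^sup>+r. ennreal (snd (\<omega>, S t \<omega> * r)) \<partial>\<kappa> t 1 \<partial>M)"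
      by (rule transition[OF t, of "\<lambda>p. ennreal (snd p)"]) measurable
    also have "\<dots> = (\<integral>\<^sup>+\<omega>. ennreal (S t \<omega>) * (\<integral>\<^sup>+r. ennreal r \<partial>\<kappa> t 1) \<partial>M)"
    proof (rule nn_integral_cong_AE)
      show "AE \<omega> in M. (\<integral>\<^sup>+r. ennreal (snd (\<omega>, S t \<omega> * r)) \<partial>\<kappa> t 1) = ennreal (S t \<omega>) * (\<integral>\<^sup>+r. ennreal r \<partial>\<kappa> t 1)"
        using S_pos[of t] t
        by (auto elim!: eventually_mono simp: ennreal_mult' nn_integral_cmult)
    qed
    also have "\<dots> = (\<integral>\<^sup>+r. ennreal r \<partial>\<kappa> t 1)"
      using S_mean[of t] t S_M[of t] by (subst nn_integral_multc) auto
    finally show ?thesis ..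
  qed
  have "\<forall>t. \<exists>f. t < N \<longrightarrow> f \<in> borel_measurable borel \<and> (\<forall>x. 0 \<le> f x) \<and> (\<forall>x\<le>0. f x = 0) \<and>
     \<kappa> t 1 = density lborel (\<lambda>x. ennreal (f x)) \<and>
     (\<forall>K>0. \<forall>s>0. put_gamma \<kappa> t K s = K\<^sup>2 / s ^ 3 * f (K / s))"
    using put_gamma_return_density[OF rm ir] by blast
  then obtain f where f: "\<And>t. t < N \<Longrightarrow> f t \<in> borel_measurable borel \<and> (\<forall>x. 0 \<le> f t x) \<and> (\<forall>x\<le>0. f t x = 0) \<and>
     \<kappa> t 1 = density lborel (\<lambda>x. ennreal (f t x)) \<and>
     (\<forall>K>0. \<forall>s>0. put_gamma \<kappa> t K s = K\<^sup>2 / s ^ 3 * f t (K / s))"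
    by metis
  have put: "ennreal (put_price \<kappa> t K s) = (\<integral>\<^sup>+r. ennreal (max (K - s * r) 0) \<partial>\<kappa> t 1)"
    if t: "t < N" and s: "s > 0" for t K s
  proof -
    note [measurable_cong] = k1(2)[OF t]
    have "ennreal (put_price \<kappa> t K s) = (\<integral>\<^sup>+x. ennreal (max (K - x) 0) \<partial>\<kappa> t s)"
      unfolding put_price_def
      by (rule nn_integral_eq_integral[OF integrable_put_payoff[OF markov_kernel[OF mk t s]], symmetric]) simp
    also have "\<dots> = (\<integral>\<^sup>+r. ennreal (max (K - s * r) 0) \<partial>\<kappa> t 1)"
      unfolding independent_returns_kernel[OF mk ir t s] by (subst nn_integral_distr) measurable
    finally show ?thesis .
  qed
  interpret withdrawal_guarantee M N w \<kappa> f F S x0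
  proof (intro withdrawal_guarantee.intro return_model.intro withdrawal_guarantee_axioms.intro)
    fix t assume t: "t < N"
    note ft = f[OF t]
    show "f t \<in> borel_measurable borel" "\<kappa> t 1 = density lborel (\<lambda>x. ennreal (f t x))"
      "\<And>x. 0 \<le> f t x" "\<And>x. x \<le> 0 \<Longrightarrow> f t x = 0"
      "\<And>K s. K > 0 \<Longrightarrow> s > 0 \<Longrightarrow> put_gamma \<kappa> t K s = K\<^sup>2 / s ^ 3 * f t (K / s)"
      using ft by blast+
    show "prob_space (\<kappa> t 1)" "(\<integral>\<^sup>+r. ennreal r \<partial>\<kappa> t 1) = 1"
      "\<And>K s. K > 0 \<Longrightarrow> s > 0 \<Longrightarrow> ennreal (put_price \<kappa> t K s) = (\<integral>\<^sup>+r. ennreal (max (K - s * r) 0) \<partial>\<kappa> t 1)"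
      using k1(1)[OF t] mean[OF t] put[OF t] by blast+
    show "(\<integral>\<^sup>+\<omega>. \<phi> (\<omega>, S (Suc t) \<omega>) \<partial>M) = (\<integral>\<^sup>+\<omega>. \<integral>\<^sup>+r. \<phi> (\<omega>, S t \<omega> * r) \<partial>\<kappa> t 1 \<partial>M)"
      if "\<phi> \<in> borel_measurable (F t \<Otimes>\<^sub>M borel)" for \<phi>
      by (rule transition[OF t that])
  qed (use assms(1-5) sub S_F S_pos in auto)
  have main: "AE \<omega> in M. depletion_time N S w x0 \<omega> > enat t \<longrightarrow>
        (let X = fund S w x0 t \<omega>; \<zeta> = fund_units S w x0 t \<omega> in
          set_integrable lborel {w / \<zeta><..}
            (\<lambda>k'. \<zeta>\<^sup>2 * weight \<kappa> N w t (\<zeta> * k') * put_price \<kappa> t k' (S t \<omega>)) \<and>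
          guarantee_value N M F S w x0 t \<omega> =
            (LINT k':{w / \<zeta><..}|lborel. \<zeta>\<^sup>2 * weight \<kappa> N w t (\<zeta> * k') * put_price \<kappa> t k' (S t \<omega>)) \<and>
          set_integrable lborel {w<..} (\<lambda>k. weight \<kappa> N w t k * put_price \<kappa> t k X) \<and>
          guarantee_value N M F S w x0 t \<omega> =
            (LINT k:{w<..}|lborel. weight \<kappa> N w t k * put_price \<kappa> t k X))"
    if "t \<le> N - 2" for t
  proof -
    have t: "Suc (Suc t) \<le> N" "t \<le> N" "t < N" using that \<open>N \<ge> 2\<close> by auto
    show ?thesis
      using guarantee_value_eq_claim_value[OF t(1)] S_pos[OF t(2)]
    proof eventually_elim
      case (elim \<omega>)
      show ?case
      proof
        assume T: "enat t < depletion_time N S w x0 \<omega>"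
        define x where "x = fund S w x0 t \<omega>"
        define \<zeta> where "\<zeta> = fund_units S w x0 t \<omega>"
        have x: "x > 0" using T t(2) by (simp add: less_depletion_time_iff x_def)
        have \<zeta>: "\<zeta> > 0" "x = \<zeta> * S t \<omega>"
          using x elim(2) by (simp_all add: \<zeta>_def fund_units_def x_def)
        have hom: "put_price \<kappa> t (\<zeta> * k) x = \<zeta> * put_price \<kappa> t k (S t \<omega>)" if "k > 0" for k
          unfolding \<zeta>(2) by (rule independent_returnsD[OF ir t(3) \<zeta>(1) that elim(2)])
        note int = claim_value_eq_put_integral[OF t(1) x]
        note resc = put_integral_rescale[where P="put_price \<kappa> t" and g="weight \<kappa> N w t", OF \<zeta>(1) \<open>w > 0\<close> \<zeta>(2) hom int(1)]
        have "guarantee_value N M F S w x0 t \<omega> = (LINT k:{w<..}|lborel. weight \<kappa> N w t k * put_price \<kappa> t k x)"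
          using elim(1) T int(3) by (simp add: x_def)
        then show "let X = fund S w x0 t \<omega>; \<zeta> = fund_units S w x0 t \<omega> in
          set_integrable lborel {w / \<zeta><..}
            (\<lambda>k'. \<zeta>\<^sup>2 * weight \<kappa> N w t (\<zeta> * k') * put_price \<kappa> t k' (S t \<omega>)) \<and>
          guarantee_value N M F S w x0 t \<omega> =
            (LINT k':{w / \<zeta><..}|lborel. \<zeta>\<^sup>2 * weight \<kappa> N w t (\<zeta> * k') * put_price \<kappa> t k' (S t \<omega>)) \<and>
          set_integrable lborel {w<..} (\<lambda>k. weight \<kappa> N w t k * put_price \<kappa> t k X) \<and>
          guarantee_value N M F S w x0 t \<omega> =
            (LINT k:{w<..}|lborel. weight \<kappa> N w t k * put_price \<kappa> t k X)"
          unfolding Let_def x_def[symmetric] \<zeta>_def[symmetric] using int(1) resc by simp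
      qed
    qed
  qed
  \<comment> \<open>The fund starts at the positive constant \<open>x0\<close>, so the condition at
    time 0 holds for every \<omega>.\<close>
  have "enat 0 < depletion_time N S w x0 \<omega>" for \<omega>
    using \<open>x0 > 0\<close> by (subst less_depletion_time_iff) auto
  then have "AE \<omega> in M. guarantee_value N M F S w x0 0 \<omega> =
        (LINT k:{w<..}|lborel. weight \<kappa> N w 0 k * put_price \<kappa> 0 k x0)"
    using main[of 0] by (auto simp: Let_def elim!: eventually_mono)
  with main show ?thesis by blast
qed

end
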